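(* Let $M$ be the cylinder in $\mathbb R^3$ and let $K:M\times M\to\mathbb R$ have the form $K(P,Q)=g(d(P,Q)^2)$ for all $P,Q\in M$, where $g:[0,\infty)\to\mathbb R$ is differentiable with locally Lipschitz continuous derivative. Let $\rho_0\in\mathcal P_\infty(\mathcal B_\varepsilon)$. Then there exist a time $T>0$, a compact set $Q$ with $\operatorname{supp}(\rho_0)\subset Q\subset\mathcal B_\varepsilon$, and a unique weak solution to the aggregation model $\partial_t\rho-\nabla_M\cdot(\rho\,\nabla_MK*\rho)=0$ on $\mathcal B_\varepsilon$ among all curves in $C([0,T);\mathcal P(Q))$ starting from $\rho_0$, where $\mathcal P(Q)$ denotes the set of probability measures supported within $Q$.
   Context: $M=\{(\cos x,\sin x,z): x\in[0,2\pi),\ z\in\mathbb R\}\subset\mathbb R^3$ is the cylinder with the metric induced from $\mathbb R^3$ and intrinsic (geodesic) distance $d$. Fix $\varepsilon\in(0,\pi)$ and set $\mathcal B_\varepsilon=\{(\cos x,\sin x,z): x\in(0,\pi-\varepsilon),\ z\in\mathbb R\}$. For $P,Q\in\mathcal B_\varepsilon$ with coordinates $(x,z),(\bar x,\bar z)\in(0,\pi-\varepsilon)\times\mathbb R$, $d(P,Q)=((x-\bar x)^2+(z-\bar z)^2)^{1/2}$ and the Riemannian logarithm is $\log_PQ=(\bar x-x)e_x+(\bar z-z)e_z$, where $e_x=(-\sin x,\cos x,0)$, $e_z=(0,0,1)$. $\mathcal P(\mathcal B_\varepsilon)$ is the set of Borel probability measures on $\mathcal B_\varepsilon$; $\mathcal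 P_\infty(\mathcal B_\varepsilon)$ is the subset of those with compact support in $\mathcal B_\varepsilon$. $C([0,T);\cdot)$ denotes curves continuous for the narrow topology. For a curve $(\rho_t)_{t\in[0,T)}$ of compactly supported probability measures on $\mathcal B_\varepsilon$ the velocity field is $v[\rho](P,t)=-\int_{\mathcal B_\varepsilon}\nabla_MK_R(P)\,d\rho_t(R)$, where $K_R(P)=K(P,R)$, $\nabla_M$ is the manifold gradient in $P$, and $\nabla_MK_R(P)=-2g'(d(P,R)^2)\log_PR$ for $P,R\in\mathcal B_\varepsilon$. Given a time-dependent vector field $X$ on $\mathcal B_\varepsilon$ and $\Sigma\subset\mathcal B_\varepsilon$, a flow map generated by $(X,\Sigma)$ on $[0,T)$ is a map $\Psi_X:\Sigma\times[0,T)\to\mathcal B_\varepsilon$, written $\Psi_X^t(p)$, with $\frac{d}{dt}\Psi_X^t(p)=X(\Psi_X^t(p),t)$ and $\Psi_X^0(p)=p$ for all $p\in\Sigma$, $t\in[0,T)$. A curve $(\rho_t)_{t\in[0,T)}\subset\mathcal P(\mathcal B_\varepsilon)$ is a weak solution if $v[\rho]$ generates a unique flow map $\Psi_{v[\rho]}$ defined on $\operatorname{supp}(\rho_0)\times[0,T)$ and $\rho_t=\Psi^t_{v[\rho]}\#\rho_0$ (push-forward) for all $t\in[0,T)$. *)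

theory Defs
  imports "HOL-Probability.Probability"
begin

definition cyl_point :: "real \<Rightarrow> real \<Rightarrow> real^3" where
  "cyl_point x z = vector [cos x, sin x, z]"

definition cylinder :: "(real^3) set" where
  "cylinder = {cyl_point x z | x z. x \<in> {0..<2*pi}}"

definition strip :: "real \<Rightarrow> (real^3) set" where
  "strip \<epsilon> = {cyl_point x z | x z. x \<in> {0<..<pi - \<epsilon>}}"

text \<open>Infimum of the lengths of the piecewise C1 paths in \<open>M\<close> joining \<open>P\<close> to \<open>Q\<close>. A
  \<^const>\<open>valid_path\<close> may have unbounded derivative near its exceptional points; using
  \<open>has_integral\<close> (rather than the total function \<^const>\<open>integral\<close>, which is 0 on
  non-integrable functions) discards the paths of infinite length.\<close>

definition geodesic_dist :: "'a::euclidean_space set \<Rightarrow> 'a \<Rightarrow> 'a \<Rightarrow> real" where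
  "geodesic_dist M P Q = Inf {L. \<exists>\<gamma>. valid_path \<gamma> \<and> path_image \<gamma> \<subseteq> M \<and>
      pathstart \<gamma> = P \<and> pathfinish \<gamma> = Q \<and>
      ((\<lambda>t. norm (vector_derivative \<gamma> (at t))) has_integral L) {0..1}}"

text \<open>At \<open>P = (cos x, sin x, z)\<close> the vector \<open>(-P\<^sub>2, P\<^sub>1, 0)\<close> is \<open>e\<^sub>x = (-sin x, cos x, 0)\<close>.\<close>

definition cyl_tangent_space :: "real^3 \<Rightarrow> (real^3) set" where
  "cyl_tangent_space P = span {vector [- (P $ 2), P $ 1, 0], vector [0, 0, 1]}"

text \<open>The manifold gradient for the metric induced from the ambient space: the tangent vector
  representing the differential of \<open>f\<close> along the cylinder. Only the values of \<open>f\<close> on the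
  cylinder enter, because the derivative is taken within it. Such a derivative is determined
  on tangent vectors only, so the restriction to tangent \<open>v\<close> is what makes the gradient unique.\<close>

definition cyl_grad :: "(real^3 \<Rightarrow> real) \<Rightarrow> real^3 \<Rightarrow> real^3" where
  "cyl_grad f P = (THE v. v \<in> cyl_tangent_space P \<and>
      (f has_derivative (\<lambda>h. v \<bullet> h)) (at P within cylinder))"


definition borel_probs :: "'a::euclidean_space set \<Rightarrow> 'a measure set" where
  "borel_probs S = {\<mu>. prob_space \<mu> \<and> sets \<mu> = sets (restrict_space borel S)}"

definition supp :: "'a::euclidean_space measure \<Rightarrow> 'a set" where
  "supp \<mu> = {p \<in> space \<mu>. \<forall>U. open U \<and> p \<in> U \<longrightarrow> 0 < emeasure \<mu> (U \<inter> space \<mu>)}"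

definition borel_probs_compact :: "'a::euclidean_space set \<Rightarrow> 'a measure set" where
  "borel_probs_compact S = {\<mu> \<in> borel_probs S. compact (supp \<mu>)}"

definition borel_probs_within :: "'a::euclidean_space set \<Rightarrow> 'a set \<Rightarrow> 'a measure set" where
  "borel_probs_within S Q = {\<mu> \<in> borel_probs S. supp \<mu> \<subseteq> Q}"

definition narrow_topology :: "'a::euclidean_space set \<Rightarrow> 'a measure topology" where
  "narrow_topology S = topology_generated_by
     {{\<mu> \<in> borel_probs S. (\<integral>p. f p \<partial>\<mu>) \<in> U} | (f :: 'a \<Rightarrow> real) U.
        continuous_on S f \<and> bounded (f ` S) \<and> open U}"

text \<open>The space \<open>C([0,T); P(Q))\<close>. Curves are total functions of time whose values outside
  \<open>[0,T)\<close> are irrelevant.\<close>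

definition narrow_curve ::
    "'a::euclidean_space set \<Rightarrow> 'a set \<Rightarrow> real \<Rightarrow> (real \<Rightarrow> 'a measure) \<Rightarrow> bool" where
  "narrow_curve S Q T \<rho> \<longleftrightarrow>
     continuous_map (top_of_set {0..<T})
       (subtopology (narrow_topology S) (borel_probs_within S Q)) \<rho>"


text \<open>The measures \<open>\<rho> t\<close> live on the strip, so the integral is over the strip.\<close>

definition velocity ::
    "(real^3 \<Rightarrow> real^3 \<Rightarrow> real) \<Rightarrow> (real \<Rightarrow> (real^3) measure) \<Rightarrow> real^3 \<Rightarrow> real \<Rightarrow> real^3" where
  "velocity K \<rho> P t = - (\<integral>R. cyl_grad (\<lambda>P'. K P' R) P \<partial>(\<rho> t))"

text \<open>The time derivative is one-sided at \<open>t = 0\<close>.\<close>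

definition flow_map ::
    "'a::euclidean_space set \<Rightarrow> ('a \<Rightarrow> real \<Rightarrow> 'a) \<Rightarrow> 'a set \<Rightarrow> real \<Rightarrow> (real \<Rightarrow> 'a \<Rightarrow> 'a) \<Rightarrow> bool"
where
  "flow_map B X \<Sigma> T \<Psi> \<longleftrightarrow>
     (\<forall>p\<in>\<Sigma>. \<Psi> 0 p = p \<and>
        (\<forall>t\<in>{0..<T}. \<Psi> t p \<in> B \<and>
           ((\<lambda>s. \<Psi> s p) has_vector_derivative X (\<Psi> t p) t) (at t within {0..<T})))"

text \<open>The push-forward of \<open>\<mu>\<close>, of full measure on its support, under a map defined only there.
  Measurability is stated because \<^const>\<open>distr\<close> is meaningless without it.\<close>

definition is_pushforward ::
    "'a::euclidean_space set \<Rightarrow> ('a \<Rightarrow> 'a) \<Rightarrow> 'a measure \<Rightarrow> 'a measure \<Rightarrow> bool" where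
  "is_pushforward B \<psi> \<mu> \<nu> \<longleftrightarrow>
     \<psi> \<in> restrict_space \<mu> (supp \<mu>) \<rightarrow>\<^sub>M restrict_space borel B \<and>
     \<nu> = distr (restrict_space \<mu> (supp \<mu>)) (restrict_space borel B) \<psi>"

text \<open>Flow maps are total functions, so their uniqueness means agreement on
  \<open>supp (\<rho> 0) \<times> [0,T)\<close>.\<close>

definition weak_solution ::
    "real \<Rightarrow> (real^3 \<Rightarrow> real^3 \<Rightarrow> real) \<Rightarrow> real \<Rightarrow> (real \<Rightarrow> (real^3) measure) \<Rightarrow> bool" where
  "weak_solution \<epsilon> K T \<rho> \<longleftrightarrow>
     (\<forall>t\<in>{0..<T}. \<rho> t \<in> borel_probs (strip \<epsilon>)) \<and>
     (\<exists>\<Psi>. flow_map (strip \<epsilon>) (velocity K \<rho>) (supp (\<rho> 0)) T \<Psi> \<and>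
        (\<forall>\<Phi>. flow_map (strip \<epsilon>) (velocity K \<rho>) (supp (\<rho> 0)) T \<Phi> \<longrightarrow>
           (\<forall>t\<in>{0..<T}. \<forall>p\<in>supp (\<rho> 0). \<Phi> t p = \<Psi> t p)) \<and>
        (\<forall>t\<in>{0..<T}. is_pushforward (strip \<epsilon>) (\<Psi> t) (\<rho> 0) (\<rho> t)))"

end

theory Submission
  imports Defs
begin

text \<open>
  The strip is isometric to the flat strip \<open>(0, \<pi> - \<epsilon>) \<times> \<real>\<close>, and in this chart the model is a mean
  field equation: a particle at \<open>p\<close> moves with the average over all particles \<open>r\<close> of \<open>k (r - p)\<close>, where
  \<open>k w = 2 g' (\<bar>w\<bar>\<^sup>2) w\<close> is Lipschitz on every ball. The proof consists of this reduction and of a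
  Picard argument.

  For the reduction, the intrinsic distance between points of the strip is the Euclidean distance
  in the chart: a path on the cylinder can be unrolled without becoming longer, and points whose
  angles differ by at most \<open>\<pi>\<close> gain nothing from paths that wind around
  (\<open>length_path_in_cylinder_ge\<close>, \<open>geodesic_dist_chart\<close>). The gradient of the
  potential is then computed by the chain rule (\<open>cyl_grad_interaction\<close>), and flow maps of the velocity
  field become solutions of the plane equation (\<open>flow_map_velocity_iff\<close>).

  For existence, label the particles by their initial positions in the support of \<open>\<rho>\<^sub>0\<close>. The displacements of
  all particles together form one curve in a Banach space of bounded continuous functions, which solves a
  Lipschitz differential equation (\<open>mean_field_flow\<close>). The set \<open>Q\<close> is a closed \<open>\<delta>\<close>-neighbourhood
  of the support in the chart, and \<open>T\<close> is so small that no particle can travel farther than \<open>\<delta>\<close>; hence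
  truncating the kernel to make it globally Lipschitz and bounded does not change the equation
  (\<open>local_mean_field_flow\<close>). The push-forward of \<open>\<rho>\<^sub>0\<close> under the flow is the solution. Its field generates
  no other flow, by Gronwall's lemma on each compact time interval (\<open>transport_ode_unique\<close>).

  For uniqueness, a second solution supported in \<open>Q\<close> is the push-forward of \<open>\<rho>\<^sub>0\<close> under its own flow, and
  almost every particle of that flow remains in \<open>Q\<close> for all times (\<open>AE_path_stays_in_supports\<close>). On these particles the two
  flows solve the same mean field equation, and for short times the distance between them is at most half of itself
  (\<open>mean_field_ode_unique\<close>). So the flows agree almost everywhere, and so do their push-forwards.
\<close>

section \<open>The unrolling chart of the strip\<close>

definition chart :: "real \<times> real \<Rightarrow> real^3" where
  "chart p = cyl_point (fst p) (snd p)"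

text \<open>The angle is read off through \<open>arctan\<close> of the cotangent. This is smooth in a neighbourhood
  in space of the half of the cylinder with positive second component, which contains the strip, and
  its differential there involves tangential components only; reading the angle off the first
  component by \<open>arccos\<close> would not have the second property.\<close>
definition coord :: "real^3 \<Rightarrow> real \<times> real" where
  "coord P = (pi/2 - arctan (P$1 / P$2), P$3)"

text \<open>The differential of the chart at the point over \<open>P\<close>, in the orthonormal frame \<open>e\<^sub>x\<close>, \<open>e\<^sub>z\<close>.\<close>
definition frame :: "real^3 \<Rightarrow> real \<times> real \<Rightarrow> real^3" where
  "frame P w = fst w *\<^sub>R vector [- (P$2), P$1, 0] + snd w *\<^sub>R vector [0, 0, 1]"

text \<open>On the cylinder this is the adjoint of \<^const>\<open>frame\<close> and its left inverse, hence
  the differential of \<^const>\<open>coord\<close> where the second component is positive.\<close>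
definition coframe :: "real^3 \<Rightarrow> real^3 \<Rightarrow> real \<times> real" where
  "coframe P h = (P$1 * h$2 - P$2 * h$1, h$3)"

definition chart_dom :: "real \<Rightarrow> (real \<times> real) set" where
  "chart_dom \<epsilon> = {0<..<pi - \<epsilon>} \<times> UNIV"

lemma chart_nth [simp]: "chart p $ 1 = cos (fst p)" "chart p $ 2 = sin (fst p)" "chart p $ 3 = snd p"
  by (simp_all add: chart_def cyl_point_def)

lemma frame_nth [simp]: "frame P w $ 1 = - (P$2) * fst w" "frame P w $ 2 = P$1 * fst w"
  "frame P w $ 3 = snd w"
  by (simp_all add: frame_def)

lemma strip_eq_chart_image: "strip \<epsilon> = chart ` chart_dom \<epsilon>"
  by (force simp: strip_def chart_dom_def chart_def)

lemma in_cylinder_iff: "P \<in> cylinder \<longleftrightarrow> (P$1)\<^sup>2 + (P$2)\<^sup>2 = 1"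
proof
  assume "P \<in> cylinder"
  then show "(P$1)\<^sup>2 + (P$2)\<^sup>2 = 1"
    by (auto simp: cylinder_def cyl_point_def)
next
  assume "(P$1)\<^sup>2 + (P$2)\<^sup>2 = 1"
  then obtain t where "0 \<le> t" "t < 2*pi" "P$1 = cos t" "P$2 = sin t"
    by (rule sincos_total_2pi)
  then have "P = cyl_point t (P$3)" "t \<in> {0..<2*pi}"
    by (auto simp: cyl_point_def vec_eq_iff forall_3)
  then show "P \<in> cylinder"
    unfolding cylinder_def by blast
qed

lemma chart_in_cylinder [simp]: "chart p \<in> cylinder"
  by (simp add: in_cylinder_iff)

lemma coord_chart:
  assumes "0 < fst p" "fst p < pi"
  shows "coord (chart p) = p"
proof -
  have "arctan (cos (fst p) / sin (fst p)) = pi/2 - fst p"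
    using arctan_tan[of "pi/2 - fst p"] assms by (simp add: tan_def sin_diff cos_diff)
  then show ?thesis
    by (simp add: coord_def prod_eq_iff)
qed

lemma chart_coord_half_cylinder:
  assumes "P \<in> cylinder" "P$2 > 0"
  shows "chart (coord P) = P" "0 < fst (coord P)" "fst (coord P) < pi"
proof -
  obtain x z where xz: "P = chart (x, z)" "0 \<le> x" "x < 2*pi"
    using assms by (auto simp: cylinder_def chart_def)
  moreover have "x \<noteq> 0" using assms xz by auto
  moreover have "x < pi"
    using assms xz sin_le_zero[of x] by (cases "x < pi") auto
  ultimately show "chart (coord P) = P" "0 < fst (coord P)" "fst (coord P) < pi"
    by (auto simp: coord_chart)
qed

lemma chart_coord:
  assumes "P \<in> strip \<epsilon>" "0 < \<epsilon>"
  shows "chart (coord P) = P" "coord P \<in> chart_dom \<epsilon>"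
  using assms coord_chart by (auto simp: strip_eq_chart_image chart_dom_def)

lemma strip_half_cylinder:
  assumes "P \<in> strip \<epsilon>" "0 < \<epsilon>"
  shows "P \<in> cylinder" "P$2 > 0"
  using assms by (auto simp: strip_eq_chart_image chart_dom_def intro!: sin_gt_zero)

lemma norm_vec3_sq:
  fixes v :: "real^3"
  shows "(norm v)\<^sup>2 = (v$1)\<^sup>2 + (v$2)\<^sup>2 + (v$3)\<^sup>2"
  by (simp add: norm_vec_def L2_set_def sum_3)

lemma norm_prod_sq: "(norm (w :: real \<times> real))\<^sup>2 = (fst w)\<^sup>2 + (snd w)\<^sup>2"
  by (simp add: norm_prod_def)

lemma norm_frame:
  assumes "P \<in> cylinder"
  shows "norm (frame P w) = norm w"
proof -
  have "(norm (frame P w))\<^sup>2 = ((P$1)\<^sup>2 + (P$2)\<^sup>2) * (fst w)\<^sup>2 + (snd w)\<^sup>2"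
    by (simp add: norm_vec3_sq algebra_simps power_mult_distrib)
  then have "(norm (frame P w))\<^sup>2 = (norm w)\<^sup>2"
    using assms by (simp add: in_cylinder_iff norm_prod_sq)
  then show ?thesis by simp
qed

lemma frame_inner: "frame P w \<bullet> h = w \<bullet> coframe P h"
  by (simp add: inner_vec_def sum_3 coframe_def inner_prod_def algebra_simps)

lemma coframe_frame:
  assumes "P \<in> cylinder"
  shows "coframe P (frame P w) = w"
proof -
  have "coframe P (frame P w) = (((P$1)\<^sup>2 + (P$2)\<^sup>2) * fst w, snd w)"
    by (simp add: coframe_def power2_eq_square algebra_simps)
  then show ?thesis
    using assms by (simp add: in_cylinder_iff)
qed

lemma bounded_linear_frame: "bounded_linear (frame P)"
  unfolding frame_def
  by (intro bounded_linear_intros bounded_linear_fst bounded_linear_snd)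

lemma bounded_linear_coframe: "bounded_linear (coframe P)"
  unfolding coframe_def
  by (intro bounded_linear_Pair bounded_linear_sub bounded_linear_const_mult bounded_linear_vec_nth)

lemma tangent_space_eq_range_frame: "cyl_tangent_space P = range (frame P)"
  unfolding cyl_tangent_space_def span_insert span_empty
  by (auto simp: frame_def image_iff algebra_simps)
     (metis add.commute diff_add_cancel fst_conv snd_conv)+

lemma chart_has_derivative: "(chart has_derivative frame (chart p)) (at p within S)"
proof -
  have eq: "chart = (\<lambda>p. cos (fst p) *\<^sub>R axis 1 1 + sin (fst p) *\<^sub>R axis 2 1 + snd p *\<^sub>R axis 3 1)"
    by (auto simp: fun_eq_iff vec_eq_iff forall_3 axis_def)
  show ?thesis
    unfolding eq
    by (rule derivative_eq_intros refl)+
       (auto simp: fun_eq_iff vec_eq_iff forall_3 axis_def frame_def)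
qed

lemma coord_has_derivative:
  assumes "P \<in> cylinder" "P$2 > 0"
  shows "(coord has_derivative coframe P) (at P within S)"
proof -
  have nz: "P$2 \<noteq> 0" using assms by simp
  have eq: "1 + (P$1 / P$2)\<^sup>2 = 1 / (P$2)\<^sup>2"
    using assms by (simp add: in_cylinder_iff field_simps)
  have D: "((\<lambda>P. P $ i) has_derivative (\<lambda>h. h $ i)) (at P within S)" for i and P :: "real^3"
    by (rule bounded_linear_imp_has_derivative[OF bounded_linear_vec_nth])
  have A: "((\<lambda>P. arctan (P$1 / P$2)) has_derivative
      (\<lambda>h. inverse (1 + (P$1 / P$2)\<^sup>2) * ((h$1 * P$2 - P$1 * h$2) / (P$2 * P$2)))) (at P within S)"
    by (rule has_derivative_eq_rhs, rule DERIV_arctan[THEN DERIV_compose_FDERIV],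
        rule has_derivative_divide'[OF D D nz]) (simp add: mult.commute)
  have "((\<lambda>P. (pi/2 - arctan (P$1 / P$2), P$3)) has_derivative
      (\<lambda>h. (0 - inverse (1 + (P$1 / P$2)\<^sup>2) * ((h$1 * P$2 - P$1 * h$2) / (P$2 * P$2)), h$3)))
      (at P within S)"
    by (intro has_derivative_Pair has_derivative_diff has_derivative_const A D)
  moreover have "(\<lambda>h. (0 - inverse (1 + (P$1 / P$2)\<^sup>2) * ((h$1 * P$2 - P$1 * h$2) / (P$2 * P$2)), h$3))
      = coframe P"
    unfolding eq coframe_def using nz by (auto simp: fun_eq_iff power2_eq_square)
  moreover have "coord = (\<lambda>P. (pi/2 - arctan (P$1 / P$2), P$3))"
    by (simp add: fun_eq_iff coord_def)
  ultimately show ?thesis by simp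
qed

lemma chart_path_has_vector_derivative:
  assumes "(\<gamma> has_vector_derivative v) (at t within S)"
  shows "((\<lambda>s. chart (\<gamma> s)) has_vector_derivative frame (chart (\<gamma> t)) v) (at t within S)"
  using has_derivative_compose[OF assms[unfolded has_vector_derivative_def] chart_has_derivative]
  by (simp add: has_vector_derivative_def linear_cmul[OF bounded_linear.linear[OF bounded_linear_frame]])

lemma coord_path_has_vector_derivative:
  assumes "(\<gamma> has_vector_derivative v) (at t within S)" "\<gamma> t \<in> cylinder" "\<gamma> t $ 2 > 0"
  shows "((\<lambda>s. coord (\<gamma> s)) has_vector_derivative coframe (\<gamma> t) v) (at t within S)"
  using has_derivative_compose[OF assms(1)[unfolded has_vector_derivative_def]
      coord_has_derivative[OF assms(2,3)]]
  by (simp add: has_vector_derivative_def linear_cmul[OF bounded_linear.linear[OF bounded_linear_coframe]])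

section \<open>Geodesic distance in the chart\<close>

text \<open>A continuous lift through the exponential inherits differentiability, since near \<open>t\<close> its
  increments stay in the horizontal strip where the principal logarithm inverts \<open>exp\<close>.\<close>
lemma exp_lift_has_vector_derivative:
  fixes g c :: "real \<Rightarrow> complex"
  assumes "open S" "t \<in> S" and g: "continuous_on S g" and c: "\<And>s. s \<in> S \<Longrightarrow> c s = exp (g s)"
    and c': "(c has_vector_derivative c') (at t)"
  shows "(g has_vector_derivative c' / c t) (at t)"
proof -
  have "isCont g t" using assms continuous_on_eq_continuous_at by blast
  then have "\<forall>\<^sub>F s in at t. dist (g s) (g t) < pi"
    by (simp add: isCont_def tendstoD)
  moreover have "\<forall>\<^sub>F s in at t. s \<in> S"
    using assms by (simp add: eventually_at_topological) blast
  ultimately have ev: "\<forall>\<^sub>F s in at t. g t + Ln (c s / c t) = g s"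
  proof eventually_elim
    case (elim s)
    then have "\<bar>Im (g s - g t)\<bar> < pi"
      using abs_Im_le_cmod[of "g s - g t"] by (simp add: dist_norm)
    then have "Ln (exp (g s - g t)) = g s - g t" by (intro Ln_exp) auto
    then show ?case using c elim assms(2) by (simp add: exp_diff)
  qed
  have ct: "c t \<noteq> 0" using c assms(2) by simp
  have "((\<lambda>s. g t + Ln (c s / c t)) has_vector_derivative c' / c t) (at t)"
  proof -
    have "((\<lambda>z. g t + Ln (z / c t)) has_field_derivative 1 / c t) (at (c t))"
      using ct by (auto intro!: derivative_eq_intros)
    from field_vector_diff_chain_at[OF c' this] show ?thesis
      by (simp add: o_def)
  qed
  then show ?thesis
    unfolding has_vector_derivative_def
    by (rule has_derivative_transform_eventually[OF _ ev]) (simp_all add: ct)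
qed

text \<open>Unrolling a path gives a curve in the plane that is nowhere longer: the angle is the imaginary part of
  a continuous logarithm of the path seen in the complex plane. Its end points differ by \<open>q - p\<close> up
  to a multiple of \<open>2\<pi>\<close> in the angle, and adding such a multiple does not shorten this difference when
  the angles differ by at most \<open>\<pi>\<close>.\<close>
lemma length_path_in_cylinder_ge:
  fixes \<gamma> :: "real \<Rightarrow> real^3"
  assumes \<gamma>: "valid_path \<gamma>" "path_image \<gamma> \<subseteq> cylinder"
    and ends: "pathstart \<gamma> = chart p" "pathfinish \<gamma> = chart q"
    and len: "((\<lambda>t. norm (vector_derivative \<gamma> (at t))) has_integral L) {0..1}"
    and pq: "\<bar>fst q - fst p\<bar> \<le> pi"
  shows "dist p q \<le> L"
proof -
  obtain S where S: "finite S" "continuous_on {0..1} \<gamma>" "\<gamma> C1_differentiable_on ({0..1} - S)"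
    using \<gamma> by (auto simp: valid_path_def piecewise_C1_differentiable_on_def)
  have der: "(\<gamma> has_vector_derivative vector_derivative \<gamma> (at t)) (at t)" if "t \<in> {0..1} - S" for t
    using S(3) that by (auto simp: C1_differentiable_on_eq vector_derivative_works)
  have on_cyl: "(\<gamma> t $ 1)\<^sup>2 + (\<gamma> t $ 2)\<^sup>2 = 1" if "t \<in> {0..1}" for t
    using \<gamma>(2) that unfolding path_image_def by (auto simp flip: in_cylinder_iff)
  define c where "c t = Complex (\<gamma> t $ 1) (\<gamma> t $ 2)" for t
  have c_alt: "c = (\<lambda>t. of_real (\<gamma> t $ 1) + \<i> * of_real (\<gamma> t $ 2))"
    by (simp add: c_def complex_eq_iff fun_eq_iff)
  have norm_c: "cmod (c t) = 1" if "t \<in> {0..1}" for t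
    using on_cyl[OF that] by (simp add: c_def cmod_def)
  have "continuous_on {0..1} c"
    unfolding c_alt by (intro continuous_intros S)
  moreover have "c t \<noteq> 0" if "t \<in> {0..1}" for t
    using norm_c[OF that] by auto
  ultimately obtain h where h: "continuous_on {0..1} h" "\<And>t. t \<in> {0..1} \<Longrightarrow> c t = exp (h t)"
    using continuous_logarithm_on_contractible[of "{0..1}" c] convex_imp_contractible
    by (metis convex_real_interval(5))
  define \<Lambda> where "\<Lambda> t = (Im (h t), \<gamma> t $ 3)" for t
  define c' where "c' t = Complex (vector_derivative \<gamma> (at t) $ 1) (vector_derivative \<gamma> (at t) $ 2)" for t
  \<comment> \<open>Finitely many times do not affect the integral; with \<open>0\<close> at the exceptional ones the
    bound by the speed holds at every time.\<close>
  define \<Lambda>' where "\<Lambda>' t = (if t \<in> {0<..<1} - S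
      then (Im (c' t / c t), vector_derivative \<gamma> (at t) $ 3) else 0)" for t
  have \<Lambda>'_der: "(\<Lambda> has_vector_derivative \<Lambda>' t) (at t)" if t: "t \<in> {0<..<1} - S" for t
  proof -
    have D: "((\<lambda>s. \<gamma> s $ i) has_vector_derivative vector_derivative \<gamma> (at t) $ i) (at t)" for i
      using der[of t] t by (intro bounded_linear.has_vector_derivative[OF bounded_linear_vec_nth]) auto
    have "(c has_vector_derivative c' t) (at t)"
    proof -
      have "(c has_vector_derivative of_real (vector_derivative \<gamma> (at t) $ 1)
          + \<i> * of_real (vector_derivative \<gamma> (at t) $ 2)) (at t)"
        unfolding c_alt
        by (intro has_vector_derivative_add has_vector_derivative_mult_right
            bounded_linear.has_vector_derivative[OF bounded_linear_of_real] D)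
      moreover have "of_real (vector_derivative \<gamma> (at t) $ 1)
          + \<i> * of_real (vector_derivative \<gamma> (at t) $ 2) = c' t"
        by (simp add: c'_def complex_eq_iff)
      ultimately show ?thesis by simp
    qed
    then have "(h has_vector_derivative c' t / c t) (at t)"
      using t h by (intro exp_lift_has_vector_derivative[of "{0<..<1}"])
        (auto intro: continuous_on_subset)
    then have "((\<lambda>s. Im (h s)) has_vector_derivative Im (c' t / c t)) (at t)"
      by (rule bounded_linear.has_vector_derivative[OF bounded_linear_Im])
    then show ?thesis
      using t unfolding \<Lambda>_def \<Lambda>'_def
      by (auto intro!: has_vector_derivative_Pair D)
  qed
  have bound: "norm (\<Lambda>' t) \<le> norm (vector_derivative \<gamma> (at t))" for t
  proof (cases "t \<in> {0<..<1} - S")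
    case True
    have "(Im (c' t / c t))\<^sup>2 \<le> (cmod (c' t / c t))\<^sup>2"
      using abs_Im_le_cmod by (metis abs_ge_zero power2_abs power_mono)
    also have "\<dots> = (vector_derivative \<gamma> (at t) $ 1)\<^sup>2 + (vector_derivative \<gamma> (at t) $ 2)\<^sup>2"
    proof -
      have "cmod (c' t / c t) = cmod (c' t)"
        using norm_c[of t] True by (simp add: norm_divide)
      then show ?thesis by (simp add: c'_def cmod_def)
    qed
    finally have "(norm (\<Lambda>' t))\<^sup>2 \<le> (norm (vector_derivative \<gamma> (at t)))\<^sup>2"
      using True by (simp add: norm_prod_sq norm_vec3_sq \<Lambda>'_def)
    then show ?thesis by (rule power2_le_imp_le) simp
  qed (auto simp: \<Lambda>'_def)
  have "(\<Lambda>' has_integral \<Lambda> 1 - \<Lambda> 0) {0..1}"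
    by (rule fundamental_theorem_of_calculus_interior_strong[OF \<open>finite S\<close>])
       (auto simp: \<Lambda>_def intro!: continuous_intros h S \<Lambda>'_der[unfolded \<Lambda>_def])
  then have "norm (\<Lambda> 1 - \<Lambda> 0) \<le> L"
    using Henstock_Kurzweil_Integration.integral_norm_bound_integral[of \<Lambda>' "{0..1}"
        "\<lambda>t. norm (vector_derivative \<gamma> (at t))"] bound len
    by (metis has_integral_integrable has_integral_iff)
  moreover have "dist p q \<le> norm (\<Lambda> 1 - \<Lambda> 0)"
  proof -
    have \<gamma>01: "\<gamma> 0 = chart p" "\<gamma> 1 = chart q"
      using ends by (auto simp: pathstart_def pathfinish_def)
    have "exp (h 1) = cis (fst q)" "exp (h 0) = cis (fst p)"
      using h(2)[of 0] h(2)[of 1] \<gamma>01 by (auto simp: c_def complex_eq_iff)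
    then have "exp (h 1 - h 0) = exp (\<i> * of_real (fst q - fst p))"
      by (simp add: exp_diff cis_conv_exp algebra_simps)
    then obtain n :: int where "h 1 - h 0 = \<i> * of_real (fst q - fst p) + (of_int (2 * n) * pi) * \<i>"
      using exp_eq by blast
    then have "Im (h 1 - h 0) = fst q - fst p + 2 * n * pi"
      by simp
    then have n: "Im (h 1) - Im (h 0) = fst q - fst p + 2 * n * pi" by simp
    \<comment> \<open>The only place where the path could profit from going around the cylinder.\<close>
    have "\<bar>fst q - fst p\<bar> \<le> \<bar>fst q - fst p + 2 * n * pi\<bar>"
    proof (cases "n = 0")
      case False
      then have "2 * pi \<le> \<bar>2 * n * pi\<bar>"
        by (simp add: abs_mult)
      then show ?thesis using pq by linarith
    qed simp
    then have "(fst q - fst p)\<^sup>2 \<le> (Im (h 1) - Im (h 0))\<^sup>2"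
      unfolding n by (rule abs_le_square_iff[THEN iffD1])
    then have "(norm (q - p))\<^sup>2 \<le> (norm (\<Lambda> 1 - \<Lambda> 0))\<^sup>2"
      by (simp add: norm_prod_sq \<Lambda>_def \<gamma>01)
    then show ?thesis
      by (metis dist_commute dist_norm norm_ge_zero power2_le_imp_le)
  qed
  ultimately show ?thesis by linarith
qed

text \<open>The image of the straight segment in the chart attains the lower bound.\<close>
lemma geodesic_dist_chart:
  assumes "\<bar>fst q - fst p\<bar> \<le> pi"
  shows "geodesic_dist cylinder (chart p) (chart q) = dist p q"
  unfolding geodesic_dist_def
proof (rule cInf_eq_minimum)
  define \<gamma> where "\<gamma> t = chart (p + t *\<^sub>R (q - p))" for t
  have der: "(\<gamma> has_vector_derivative frame (\<gamma> t) (q - p)) (at t)" for t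
    unfolding \<gamma>_def
    by (rule chart_path_has_vector_derivative) (auto intro!: derivative_eq_intros)
  have cont: "continuous_on S \<gamma>" for S
    by (meson continuous_on_eq_continuous_within continuous_on_subset der
        has_vector_derivative_continuous subset_UNIV continuous_at_imp_continuous_on)
  have "valid_path \<gamma>"
    unfolding valid_path_def
  proof (rule C1_differentiable_imp_piecewise, unfold C1_differentiable_on_def,
      intro exI[of _ "\<lambda>t. frame (\<gamma> t) (q - p)"] conjI ballI der)
    have "(\<lambda>t. frame (\<gamma> t) (q - p)) = (\<lambda>t. (- (\<gamma> t $ 2) * fst (q - p)) *\<^sub>R axis 1 1
        + (\<gamma> t $ 1 * fst (q - p)) *\<^sub>R axis 2 1 + snd (q - p) *\<^sub>R axis 3 1)"
      by (auto simp: fun_eq_iff vec_eq_iff forall_3 axis_def)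
    then show "continuous_on {0..1} (\<lambda>t. frame (\<gamma> t) (q - p))"
      by (simp only:) (intro continuous_intros cont)
  qed
  moreover have "((\<lambda>t. norm (vector_derivative \<gamma> (at t))) has_integral dist p q) {0..1}"
    using has_integral_const_real[of "dist p q" 0 1]
    by (simp add: vector_derivative_at[OF der] \<gamma>_def norm_frame dist_norm norm_minus_commute)
  ultimately show "dist p q \<in> {L. \<exists>\<gamma>. valid_path \<gamma> \<and> path_image \<gamma> \<subseteq> cylinder \<and>
      pathstart \<gamma> = chart p \<and> pathfinish \<gamma> = chart q \<and>
      ((\<lambda>t. norm (vector_derivative \<gamma> (at t))) has_integral L) {0..1}}"
    by (auto intro!: exI[of _ \<gamma>] simp: path_image_def pathstart_def pathfinish_def \<gamma>_def)
qed (use assms length_path_in_cylinder_ge in blast)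

section \<open>The gradient of the interaction potential\<close>

text \<open>A derivative within the cylinder is determined on tangent vectors by the derivatives along the
  curves that the chart provides, so at most one tangent vector can represent it.\<close>
lemma cyl_grad_eqI:
  assumes "P = chart p" "v \<in> cyl_tangent_space P"
    and "(f has_derivative (\<lambda>h. v \<bullet> h)) (at P within cylinder)"
  shows "cyl_grad f P = v"
  unfolding cyl_grad_def
proof (rule the_equality)
  fix w assume w: "w \<in> cyl_tangent_space P \<and> (f has_derivative (\<bullet>) w) (at P within cylinder)"
  have D: "((\<lambda>q. f (chart q)) has_derivative (\<lambda>h. v \<bullet> frame P h)) (at p)"
    if "(f has_derivative (\<lambda>h. v \<bullet> h)) (at P within cylinder)" for v
  proof -
    have "(f has_derivative (\<lambda>h. v \<bullet> h)) (at (chart p) within range chart)"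
      using that unfolding assms(1) by (rule has_derivative_subset) auto
    from has_derivative_in_compose[OF chart_has_derivative this] show ?thesis
      by (simp add: assms(1))
  qed
  have "v \<bullet> frame P h = w \<bullet> frame P h" for h
    using has_derivative_unique[OF D[OF assms(3)] D] w by meson
  moreover obtain h where "v - w = frame P h"
    using w assms(2) span_diff[of v _ w] unfolding tangent_space_eq_range_frame[symmetric]
      cyl_tangent_space_def[symmetric]
    by (metis (no_types, lifting) cyl_tangent_space_def imageE tangent_space_eq_range_frame)
  ultimately have "(v - w) \<bullet> (v - w) = 0"
    by (metis inner_diff_left right_minus_eq)
  then show "w = v" by simp
qed (use assms in auto)

text \<open>The velocity, in the chart, that a unit mass at relative position \<open>w\<close> induces.\<close>
definition kern :: "(real \<Rightarrow> real) \<Rightarrow> real \<times> real \<Rightarrow> real \<times> real" where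
  "kern g' w = (2 * g' ((norm w)\<^sup>2)) *\<^sub>R w"

text \<open>Near \<open>P\<close> the potential is \<open>g\<close> of the squared Euclidean distance in the chart, so the chain
  rule applies, and \<^const>\<open>frame\<close> turns the plane gradient into a tangent vector. Only the one-sided
  derivative of \<open>g\<close> at \<open>0\<close> is at hand when \<open>P = R\<close>, which suffices because squared distances are
  nonnegative.\<close>
lemma cyl_grad_interaction:
  assumes K: "\<And>P Q. P \<in> cylinder \<Longrightarrow> Q \<in> cylinder \<Longrightarrow> K P Q = g ((geodesic_dist cylinder P Q)\<^sup>2)"
    and g: "\<And>s. 0 \<le> s \<Longrightarrow> (g has_real_derivative g' s) (at s within {0..})"
    and P: "P \<in> cylinder" "P$2 > 0" and R: "R \<in> cylinder" "R$2 > 0"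
  shows "cyl_grad (\<lambda>P'. K P' R) P = - frame P (kern g' (coord R - coord P))"
proof (rule cyl_grad_eqI)
  show "P = chart (coord P)"
    using P by (simp add: chart_coord_half_cylinder)
  interpret fr: bounded_linear "frame P" by (rule bounded_linear_frame)
  show "- frame P (kern g' (coord R - coord P)) \<in> cyl_tangent_space P"
    unfolding tangent_space_eq_range_frame fr.neg[symmetric] by blast
  define u where "u P' = (norm (coord P' - coord R))\<^sup>2" for P'
  have "(u has_derivative (\<lambda>h. 2 * ((coord P - coord R) \<bullet> coframe P h))) (at P within cylinder)"
    unfolding u_def power2_norm_eq_inner
    by (rule derivative_eq_intros coord_has_derivative P refl)+ (simp add: inner_commute fun_eq_iff)
  moreover have "(g has_derivative (\<lambda>h. h * g' (u P))) (at (u P) within u ` cylinder)"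
    by (rule has_derivative_subset[of _ _ _ "{0..}"])
      (use g[of "u P"] in \<open>auto simp: u_def has_field_derivative_def mult_commute_abs\<close>)
  ultimately have "((\<lambda>P'. g (u P')) has_derivative
      (\<lambda>h. 2 * ((coord P - coord R) \<bullet> coframe P h) * g' (u P))) (at P within cylinder)"
    by (rule has_derivative_in_compose)
  moreover have "2 * ((coord P - coord R) \<bullet> coframe P h) * g' (u P)
      = - frame P (kern g' (coord R - coord P)) \<bullet> h" for h
    by (simp add: frame_inner kern_def u_def norm_minus_commute inner_diff_left algebra_simps)
  ultimately have D: "((\<lambda>P'. g (u P')) has_derivative
      (\<lambda>h. - frame P (kern g' (coord R - coord P)) \<bullet> h)) (at P within cylinder)"
    by simp
  have eq: "g (u P') = K P' R" if "P' \<in> cylinder" "P'$2 > 0" for P'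
  proof -
    have "\<bar>fst (coord R) - fst (coord P')\<bar> \<le> pi"
      using chart_coord_half_cylinder[OF that] chart_coord_half_cylinder[OF R] by linarith
    then show ?thesis
      using geodesic_dist_chart[of "coord R" "coord P'"] that R
      by (simp add: K chart_coord_half_cylinder u_def dist_norm)
  qed
  \<comment> \<open>The derivative is taken within the cylinder, all of whose points close to \<open>P\<close> lie in this half.\<close>
  have "open {P' :: real^3. P'$2 > 0}"
    by (intro open_Collect_less continuous_intros)
  then have "\<forall>\<^sub>F P' in at P within cylinder. g (u P') = K P' R"
    unfolding eventually_at_topological using P eq by blast
  then show "((\<lambda>P'. K P' R) has_derivative (\<lambda>h. - frame P (kern g' (coord R - coord P)) \<bullet> h))
      (at P within cylinder)"
    by (rule has_derivative_transform_eventually[OF D]) (use P eq in auto)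
qed

text \<open>On a compact interval the locally Lipschitz \<open>g'\<close> is bounded and Lipschitz, and so is
  the squared norm on a ball.\<close>
lemma kern_lipschitz:
  assumes "local_lipschitz (UNIV :: real set) {0..} (\<lambda>_. g')"
  shows "\<exists>L. L-lipschitz_on (cball 0 D) (kern g')"
proof (cases "0 \<le> D")
  case False
  then show ?thesis by (auto intro!: exI[of _ 0])
next
  case D: True
  have "local_lipschitz {0::real} {0..D\<^sup>2} (\<lambda>_. g')"
    by (rule local_lipschitz_subset[OF assms]) auto
  then obtain l where l: "l-lipschitz_on {0..D\<^sup>2} g'"
    by (rule local_lipschitz_compact_implies_lipschitz[OF _ compact_Icc compact_sing[of 0]]) auto
  have l0: "0 \<le> l" using l lipschitz_on_nonneg by blast
  define b where "b = \<bar>g' 0\<bar> + l * D\<^sup>2"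
  have sq: "(norm w)\<^sup>2 \<in> {0..D\<^sup>2}" if "norm w \<le> D" for w :: "real \<times> real"
    using that by (auto intro: power_mono)
  have b: "\<bar>g' s\<bar> \<le> b" if "s \<in> {0..D\<^sup>2}" for s
  proof -
    have "\<bar>g' s - g' 0\<bar> \<le> l * \<bar>s - 0\<bar>"
      using lipschitz_onD[OF l that, of 0] by (simp add: dist_real_def)
    also have "\<dots> \<le> l * D\<^sup>2" using that l0 by (intro mult_left_mono) auto
    finally show ?thesis by (simp add: b_def)
  qed
  have "norm (kern g' v - kern g' w) \<le> (4 * l * D\<^sup>2 + 2 * b) * norm (v - w)"
    if v: "norm v \<le> D" and w: "norm w \<le> D" for v w
  proof -
    have "\<bar>(norm v)\<^sup>2 - (norm w)\<^sup>2\<bar> = \<bar>norm v - norm w\<bar> * (norm v + norm w)"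
      by (simp add: power2_eq_square square_diff_square_factored abs_mult mult.commute)
    also have "\<dots> \<le> norm (v - w) * (D + D)"
      using v w by (intro mult_mono norm_triangle_ineq3) auto
    finally have sq_diff: "\<bar>(norm v)\<^sup>2 - (norm w)\<^sup>2\<bar> \<le> norm (v - w) * (2 * D)" by simp
    have "\<bar>g' ((norm v)\<^sup>2) - g' ((norm w)\<^sup>2)\<bar> \<le> l * \<bar>(norm v)\<^sup>2 - (norm w)\<^sup>2\<bar>"
      using lipschitz_onD[OF l sq[OF v] sq[OF w]] by (simp add: dist_real_def)
    also have "\<dots> \<le> l * (norm (v - w) * (2 * D))"
      by (rule mult_left_mono[OF sq_diff l0])
    finally have g_diff: "\<bar>g' ((norm v)\<^sup>2) - g' ((norm w)\<^sup>2)\<bar> \<le> l * (norm (v - w) * (2 * D))" .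
    have "kern g' v - kern g' w = (2 * (g' ((norm v)\<^sup>2) - g' ((norm w)\<^sup>2))) *\<^sub>R v
        + (2 * g' ((norm w)\<^sup>2)) *\<^sub>R (v - w)"
      by (simp add: kern_def algebra_simps)
    also have "norm \<dots> \<le> 2 * \<bar>g' ((norm v)\<^sup>2) - g' ((norm w)\<^sup>2)\<bar> * norm v
        + 2 * \<bar>g' ((norm w)\<^sup>2)\<bar> * norm (v - w)"
      by (rule order_trans[OF norm_triangle_ineq]) (simp add: abs_mult del: right_diff_distrib_numeral)
    also have "\<dots> \<le> 2 * (l * (norm (v - w) * (2 * D))) * D + 2 * b * norm (v - w)"
      using g_diff v b[OF sq[OF w]] l0 D by (intro add_mono mult_mono) auto
    finally show ?thesis by (simp add: power2_eq_square algebra_simps)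
  qed
  moreover have "0 \<le> 4 * l * D\<^sup>2 + 2 * b" using l0 by (simp add: b_def)
  ultimately have "(4 * l * D\<^sup>2 + 2 * b)-lipschitz_on (cball 0 D) (kern g')"
    by (intro lipschitz_onI) (auto simp: dist_norm)
  then show ?thesis by blast
qed

section \<open>Existence of mean field flows\<close>

text \<open>The Picard operator is a contraction of the bounded continuous curves on the whole real line when
  the time argument is cut off to \<open>[0,T]\<close>.\<close>
lemma picard_short_time:
  fixes B :: "'a::banach \<Rightarrow> 'a"
  assumes B: "L-lipschitz_on UNIV B" and T: "0 \<le> T" "L * T < 1"
  obtains u where "u 0 = u0"
    "\<And>t. t \<in> {0..T} \<Longrightarrow> (u has_vector_derivative B (u t)) (at t within {0..T})"
proof -
  have L: "0 \<le> L" using B lipschitz_on_nonneg by blast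
  have contB: "continuous_on S B" for S
    using lipschitz_on_continuous_on[OF B] continuous_on_subset by blast
  \<comment> \<open>Cutting time off turns curves on \<open>[0,T]\<close> into bounded continuous functions on the line.\<close>
  define cut where "cut t = max 0 (min T t)" for t :: real
  have cut: "cut t \<in> {0..T}" "t \<in> {0..T} \<Longrightarrow> cut t = t" for t
    using T by (auto simp: cut_def)
  define I where "I v t = u0 + integral {0..t} (\<lambda>s. B (apply_bcontfun v s))" for v and t :: real
  have cBv: "continuous_on S (\<lambda>s. B (apply_bcontfun v s))" for v S
    using continuous_on_compose2[OF contB] by (metis continuous_on_apply_bcontfun subset_UNIV)
  have intBv: "(\<lambda>s. B (apply_bcontfun v s)) integrable_on {0..t}" for v and t :: real
    using cBv by (intro integrable_continuous_real)
  have I': "(I v has_vector_derivative B (apply_bcontfun v t)) (at t within {0..T})"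
    if "t \<in> {0..T}" for v t
    unfolding I_def
    using integral_has_vector_derivative[OF cBv[of "{0..T}" v] that]
    by (auto intro!: derivative_eq_intros)
  have contI: "continuous_on {0..T} (I v)" for v
    using I' by (meson continuous_on_eq_continuous_within has_vector_derivative_continuous)
  have bc: "(\<lambda>t. I v (cut t)) \<in> bcontfun" for v
  proof -
    have "continuous_on UNIV (\<lambda>t. I v (cut t))"
      by (rule continuous_on_compose2[OF contI, of UNIV cut])
         (use cut in \<open>auto simp: cut_def intro!: continuous_intros\<close>)
    moreover have "bounded (range (\<lambda>t. I v (cut t)))"
      by (rule bounded_subset[OF compact_imp_bounded[OF compact_continuous_image[OF contI]]])
         (use cut in auto)
    ultimately show ?thesis by (auto simp: bcontfun_def)
  qed
  define A where "A v = Bcontfun (\<lambda>t. I v (cut t))" for v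
  have A: "apply_bcontfun (A v) t = I v (cut t)" for v t
    unfolding A_def by (simp add: Bcontfun_inverse[OF bc])
  have "\<forall>v w. dist (A v) (A w) \<le> (L * T) * dist v w"
  proof (intro allI dist_bound)
    fix v w t
    have "dist (A v t) (A w t) = norm (integral {0..cut t} (\<lambda>s. B (v s) - B (w s)))"
      by (simp add: A I_def dist_norm integral_diff[OF intBv intBv])
    also have "\<dots> \<le> (L * dist v w) * (cut t - 0)"
    proof (rule integral_bound)
      fix s
      have "norm (B (v s) - B (w s)) \<le> L * dist (v s) (w s)"
        using lipschitz_onD[OF B, of "v s" "w s"] by (simp add: dist_norm)
      also have "\<dots> \<le> L * dist v w"
        by (intro mult_left_mono dist_bounded L)
      finally show "norm (B (v s) - B (w s)) \<le> L * dist v w" .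
    qed (use cut[of t] in \<open>auto intro!: continuous_intros cBv\<close>)
    also have "\<dots> \<le> (L * dist v w) * T"
      using cut[of t] L by (intro mult_left_mono) auto
    finally show "dist (A v t) (A w t) \<le> (L * T) * dist v w"
      by (simp add: mult_ac)
  qed
  then obtain v where v: "A v = v"
    using banach_fix_type[of "L * T" A] L T by auto
  then have vI: "apply_bcontfun v t = I v t" if "t \<in> {0..T}" for t
    using A[of v t] cut that by simp
  show ?thesis
  proof
    show "apply_bcontfun v 0 = u0"
      using vI[of 0] T by (simp add: I_def)
    show "(apply_bcontfun v has_vector_derivative B (apply_bcontfun v t)) (at t within {0..T})"
      if "t \<in> {0..T}" for t
      by (rule has_vector_derivative_transform[OF that vI I'[OF that]])
  qed
qed

instance bcontfun :: (metric_space, banach) banach ..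

lemma bounded_linear_eval_bcontfun:
  "bounded_linear (\<lambda>f :: 'a::topological_space \<Rightarrow>\<^sub>C 'b::real_normed_vector. apply_bcontfun f x)"
  by (rule bounded_linear_intro[where K=1]) (simp_all add: norm_bounded)

lemma norm_integral_diff_le:
  fixes f g :: "'b \<Rightarrow> 'a::{banach, second_countable_topology}"
  assumes "prob_space N" "integrable N f" "integrable N g" "AE q in N. norm (f q - g q) \<le> C"
  shows "norm ((\<integral>q. f q \<partial>N) - (\<integral>q. g q \<partial>N)) \<le> C"
proof -
  interpret prob_space N by fact
  have "norm ((\<integral>q. f q \<partial>N) - (\<integral>q. g q \<partial>N)) \<le> (\<integral>q. norm (f q - g q) \<partial>N)"
    using assms integral_norm_bound[of N "\<lambda>q. f q - g q"] by simp
  also have "\<dots> \<le> (\<integral>q. C \<partial>N)"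
    using assms by (intro integral_mono_AE) auto
  finally show ?thesis by (simp add: prob_space)
qed

text \<open>The flow \<open>X t p = p + u t p\<close> solves an ordinary differential equation in a Banach space,
  namely that of the bounded continuous displacements \<open>u t\<close>. The field that a displacement generates is
  bounded by \<open>M\<close> and depends on the displacement with Lipschitz constant \<open>2L\<close>: one \<open>L\<close> for the moving
  point, one for the moving sources.\<close>
lemma mean_field_flow:
  fixes H :: "'a::euclidean_space \<Rightarrow> 'a" and c :: "'b \<Rightarrow> 'a"
  assumes N: "prob_space N" and c: "c \<in> borel_measurable N"
    and H: "L-lipschitz_on UNIV H" and M: "\<And>w. norm (H w) \<le> M"
    and T: "0 \<le> T" "4 * L * T \<le> 1"
  obtains X where "\<And>p. X 0 p = p"
    "\<And>t. continuous_on UNIV (X t)"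
    "\<And>t p. t \<in> {0..T} \<Longrightarrow>
      ((\<lambda>s. X s p) has_vector_derivative (\<integral>q. H (X t (c q) - X t p) \<partial>N)) (at t within {0..T})"
    "\<And>t p. t \<in> {0..T} \<Longrightarrow> dist (X t p) p \<le> M * t"
proof -
  interpret prob_space N by (rule N)
  note c[measurable]
  have L: "0 \<le> L" using H lipschitz_on_nonneg by blast
  have M0: "0 \<le> M" using M[of 0] norm_ge_zero order_trans by blast
  have contH: "continuous_on UNIV H" by (rule lipschitz_on_continuous_on[OF H])
  have [measurable]: "H \<in> borel_measurable borel"
    by (rule borel_measurable_continuous_onI[OF contH])
  have mu[measurable]: "apply_bcontfun u \<in> borel_measurable borel" for u :: "'a \<Rightarrow>\<^sub>C 'a"
    by (rule borel_measurable_continuous_onI) simp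
  define P where "P u p = p + apply_bcontfun u p" for u :: "'a \<Rightarrow>\<^sub>C 'a" and p
  have [measurable]: "P u \<in> borel_measurable borel" for u
    unfolding P_def[abs_def] by measurable
  define V where "V u x = (\<integral>q. H (P u (c q) - x) \<partial>N)" for u x
  have intH: "integrable N (\<lambda>q. H (P u (c q) - x))" for u x
    by (rule integrable_const_bound[of _ M]) (use M in auto)
  have V_lip: "norm (V u x - V w y) \<le> L * (dist u w + dist x y)" for u w x y
  proof -
    have "norm (H (P u (c q) - x) - H (P w (c q) - y)) \<le> L * (dist u w + dist x y)" for q
    proof -
      have "norm (H (P u (c q) - x) - H (P w (c q) - y)) \<le> L * dist (P u (c q) - x) (P w (c q) - y)"
        using lipschitz_onD[OF H] by (simp add: dist_norm)
      also have "dist (P u (c q) - x) (P w (c q) - y) \<le> dist (u (c q)) (w (c q)) + dist x y"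
        unfolding P_def dist_norm
        using norm_triangle_ineq4[of "u (c q) - w (c q)" "x - y"] by (simp add: algebra_simps)
      also have "\<dots> \<le> dist u w + dist x y"
        using dist_bounded by simp
      finally show ?thesis
        using L by (simp add: mult_left_mono)
    qed
    then show ?thesis
      unfolding V_def by (intro norm_integral_diff_le[OF N] intH) auto
  qed
  have V_bound: "norm (V u x) \<le> M" for u x
    using norm_integral_diff_le[OF N intH, where g="\<lambda>_. 0" and C=M] M by (simp add: V_def)
  have contP: "continuous_on S (P u)" for u S
    unfolding P_def[abs_def] by (intro continuous_on_add continuous_on_id continuous_on_apply_bcontfun)
  have "continuous_on UNIV (V u)" for u
    by (rule lipschitz_on_continuous_on[of L])
       (use V_lip[of u _ u] L in \<open>auto simp: lipschitz_on_def dist_norm\<close>)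
  then have bc: "(\<lambda>p. V u (P u p)) \<in> bcontfun" for u
    by (intro bcontfun_normI[of _ M] V_bound continuous_on_compose2[OF _ contP]) auto
  define B where "B u = Bcontfun (\<lambda>p. V u (P u p))" for u
  have B: "apply_bcontfun (B u) p = V u (P u p)" for u p
    unfolding B_def by (simp add: Bcontfun_inverse[OF bc])
  have "(2 * L)-lipschitz_on UNIV B"
  proof (rule lipschitz_onI)
    fix u w
    show "dist (B u) (B w) \<le> 2 * L * dist u w"
    proof (rule dist_bound)
      fix p
      have "dist (B u p) (B w p) \<le> L * (dist u w + dist (P u p) (P w p))"
        unfolding B dist_norm[of "V _ _"] by (rule V_lip)
      also have "\<dots> \<le> L * (dist u w + dist u w)"
        using dist_bounded[of u p w] L by (intro mult_left_mono add_left_mono) (auto simp: P_def)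
      finally show "dist (B u p) (B w p) \<le> 2 * L * dist u w" by simp
    qed
  qed (use L in auto)
  then obtain u where u: "u 0 = 0"
    "\<And>t. t \<in> {0..T} \<Longrightarrow> (u has_vector_derivative B (u t)) (at t within {0..T})"
    by (rule picard_short_time[OF _ T(1), of "2 * L" B 0]) (use T in auto)
  have der: "((\<lambda>s. P (u s) p) has_vector_derivative (\<integral>q. H (P (u t) (c q) - P (u t) p) \<partial>N))
      (at t within {0..T})" if "t \<in> {0..T}" for t p
    using has_vector_derivative_add[OF has_vector_derivative_const
        bounded_linear.has_vector_derivative[OF bounded_linear_eval_bcontfun u(2)[OF that]]]
    by (auto simp: P_def[abs_def] B V_def)
  show ?thesis
  proof (rule that[of "\<lambda>t. P (u t)"])
    show "dist (P (u t) p) p \<le> M * t" if t: "t \<in> {0..T}" for t p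
    proof -
      have "norm (P (u t) p - P (u 0) p) \<le> M * norm (t - 0)"
      proof (rule differentiable_bound[of "{0..T}" "\<lambda>s. P (u s) p"
          "\<lambda>s h. h *\<^sub>R V (u s) (P (u s) p)"])
        fix s assume "s \<in> {0..T}"
        then show "((\<lambda>s. P (u s) p) has_derivative (\<lambda>h. h *\<^sub>R V (u s) (P (u s) p)))
            (at s within {0..T})"
          using der by (simp add: has_vector_derivative_def V_def)
        show "onorm (\<lambda>h. h *\<^sub>R V (u s) (P (u s) p)) \<le> M"
          by (rule onorm_bound) (use M0 V_bound in \<open>auto simp: mult.commute[of M] intro!: mult_left_mono\<close>)
      qed (use t T in auto)
      then show ?thesis using t by (simp add: P_def u dist_norm)
    qed
  qed (use der contP u in \<open>auto simp: P_def\<close>)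
qed

text \<open>The function \<open>exp (-2Lt) * (norm (e t))\<^sup>2\<close> is nonincreasing.\<close>
lemma gronwall_zero:
  fixes e :: "real \<Rightarrow> 'a::real_inner"
  assumes "0 \<le> b" and e0: "e 0 = 0"
    and der: "\<And>t. t \<in> {0..b} \<Longrightarrow> (e has_vector_derivative d t) (at t within {0..b})"
    and d: "\<And>t. t \<in> {0..b} \<Longrightarrow> norm (d t) \<le> L * norm (e t)"
  shows "e b = 0"
proof -
  define w where "w t = exp (- (2 * L * t)) * (e t \<bullet> e t)" for t
  have cont: "continuous_on {0..b} e"
    using der by (meson continuous_on_eq_continuous_within has_vector_derivative_continuous)
  have "w 0 \<ge> w b"
  proof (rule DERIV_nonpos_imp_decreasing_open[OF \<open>0 \<le> b\<close>])
    show "continuous_on {0..b} w"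
      unfolding w_def by (intro continuous_intros cont)
    fix t assume t: "0 < t" "t < b"
    then have "(e has_derivative (\<lambda>h. h *\<^sub>R d t)) (at t)"
      using der[of t] at_within_Icc_at[of 0 t b] by (simp add: has_vector_derivative_def)
    from has_derivative_inner[OF this this]
    have E: "((\<lambda>s. e s \<bullet> e s) has_real_derivative 2 * (e t \<bullet> d t)) (at t)"
      unfolding has_field_derivative_def
      by (rule has_derivative_eq_rhs) (auto simp: inner_commute fun_eq_iff)
    have "(w has_real_derivative exp (- (2 * L * t)) * (2 * (e t \<bullet> d t) - 2 * L * (e t \<bullet> e t))) (at t)"
      unfolding w_def
      by (rule derivative_eq_intros E refl)+ (simp add: algebra_simps)
    moreover have "e t \<bullet> d t \<le> L * (e t \<bullet> e t)"
    proof -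
      have "e t \<bullet> d t \<le> norm (e t) * norm (d t)" by (rule norm_cauchy_schwarz)
      also have "\<dots> \<le> norm (e t) * (L * norm (e t))"
        using d[of t] t by (intro mult_left_mono) auto
      also have "\<dots> = L * (e t \<bullet> e t)"
        by (simp add: power2_norm_eq_inner[symmetric] power2_eq_square)
      finally show ?thesis .
    qed
    ultimately show "\<exists>y. (w has_real_derivative y) (at t) \<and> y \<le> 0"
      by (intro exI conjI) (auto simp: mult_le_0_iff)
  qed
  then show ?thesis
    using e0 by (simp add: w_def mult_le_0_iff) (metis inner_ge_zero inner_eq_zero_iff order_antisym)
qed

section \<open>Confinement and uniqueness of mean field flows\<close>

lemma continuous_on_if_lipschitz_on_cballs:
  fixes k :: "'a::real_normed_vector \<Rightarrow> 'b::metric_space"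
  assumes "\<And>D. \<exists>L. L-lipschitz_on (cball 0 D) k"
  shows "continuous_on UNIV k"
proof -
  have "isCont k x" for x
  proof -
    obtain L where "L-lipschitz_on (cball 0 (norm x + 1)) k" using assms by blast
    then have "continuous_on (ball 0 (norm x + 1)) k"
      using lipschitz_on_continuous_on continuous_on_subset ball_subset_cball by blast
    then show ?thesis
      by (simp add: continuous_on_eq_continuous_at)
  qed
  then show ?thesis
    by (simp add: continuous_at_imp_continuous_on)
qed

lemma integrable_kernel_shift:
  fixes k :: "'a::euclidean_space \<Rightarrow> 'a"
  assumes "finite_measure N" and k: "continuous_on UNIV k"
    and Z: "Z \<in> borel_measurable N" "AE q in N. Z q \<in> A" "bounded A"
  shows "integrable N (\<lambda>q. k (Z q - x))"
proof -
  interpret finite_measure N by fact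
  obtain r where r: "\<And>a. a \<in> A \<Longrightarrow> norm a \<le> r"
    using \<open>bounded A\<close> bounded_iff by blast
  have "bounded (k ` cball 0 (r + norm x))"
    by (intro compact_imp_bounded compact_continuous_image continuous_on_subset[OF k]) auto
  then obtain b where b: "\<And>w. norm w \<le> r + norm x \<Longrightarrow> norm (k w) \<le> b"
    by (metis bounded_iff imageI mem_cball_0)
  have [measurable]: "k \<in> borel_measurable borel"
    by (rule borel_measurable_continuous_onI[OF k])
  note Z(1)[measurable]
  show ?thesis
  proof (rule integrable_const_bound[of _ b])
    show "AE q in N. norm (k (Z q - x)) \<le> b"
      using Z(2)
    proof eventually_elim
      case (elim q)
      then show ?case
        using r[OF elim] norm_triangle_ineq4[of "Z q" x] by (intro b) linarith
    qed
  qed measurable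
qed

text \<open>The sources \<open>Z t q\<close> are given and stay in a bounded set, but the two solutions are free to go
  anywhere. Up to a fixed time each of them is bounded, by continuity, so \<open>k\<close> is Lipschitz on the
  displacements that occur and Gronwall applies with a constant that may depend on that time.\<close>
lemma transport_ode_unique:
  fixes k :: "'a::euclidean_space \<Rightarrow> 'a"
  assumes N: "prob_space N" and k: "\<And>D. \<exists>L. L-lipschitz_on (cball 0 D) k"
    and Z: "\<And>t. t \<in> {0..<T} \<Longrightarrow> Z t \<in> borel_measurable N"
      "\<And>t q. t \<in> {0..<T} \<Longrightarrow> q \<in> space N \<Longrightarrow> Z t q \<in> A" "bounded A"
    and x: "\<And>t. t \<in> {0..<T} \<Longrightarrow>
      (x has_vector_derivative (\<integral>q. k (Z t q - x t) \<partial>N)) (at t within {0..<T})"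
    and y: "\<And>t. t \<in> {0..<T} \<Longrightarrow>
      (y has_vector_derivative (\<integral>q. k (Z t q - y t) \<partial>N)) (at t within {0..<T})"
    and "x 0 = y 0" and b: "b \<in> {0..<T}"
  shows "x b = y b"
proof -
  have sub: "{0..b} \<subseteq> {0..<T}" using b by auto
  have xb: "(x has_vector_derivative (\<integral>q. k (Z t q - x t) \<partial>N)) (at t within {0..b})"
    and yb: "(y has_vector_derivative (\<integral>q. k (Z t q - y t) \<partial>N)) (at t within {0..b})"
    if "t \<in> {0..b}" for t
    using that sub by (auto intro!: has_vector_derivative_within_subset[OF x]
        has_vector_derivative_within_subset[OF y])
  have "continuous_on {0..b} x" "continuous_on {0..b} y"
    using xb yb by (meson continuous_on_eq_continuous_within has_vector_derivative_continuous)+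
  then have "bounded (x ` {0..b} \<union> y ` {0..b})"
    by (auto intro!: compact_imp_bounded compact_continuous_image)
  then obtain r where r: "\<And>t. t \<in> {0..b} \<Longrightarrow> norm (x t) \<le> r" "\<And>t. t \<in> {0..b} \<Longrightarrow> norm (y t) \<le> r"
    unfolding bounded_iff by blast
  obtain r' where r': "\<And>a. a \<in> A \<Longrightarrow> norm a \<le> r'"
    using \<open>bounded A\<close> bounded_iff by blast
  obtain L where L: "L-lipschitz_on (cball 0 (r' + r)) k" using k by blast
  note int = integrable_kernel_shift[OF prob_space.finite_measure[OF N]
      continuous_on_if_lipschitz_on_cballs[OF k] _ _ \<open>bounded A\<close>]
  have "x b - y b = 0"
  proof (rule gronwall_zero[where e="\<lambda>t. x t - y t"])
    fix t assume t: "t \<in> {0..b}"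
    then have tT: "t \<in> {0..<T}" using sub by auto
    show "((\<lambda>t. x t - y t) has_vector_derivative
        (\<integral>q. k (Z t q - x t) \<partial>N) - (\<integral>q. k (Z t q - y t) \<partial>N)) (at t within {0..b})"
      by (intro has_vector_derivative_diff xb yb t)
    have le: "norm (k (Z t q - x t) - k (Z t q - y t)) \<le> L * norm (x t - y t)" if "q \<in> space N" for q
    proof -
      have "norm (Z t q - x t) \<le> r' + r" "norm (Z t q - y t) \<le> r' + r"
        using r'[OF Z(2)[OF tT that]] r[OF t] norm_triangle_ineq4[of "Z t q"] by (meson add_mono order_trans)+
      then have "dist (k (Z t q - x t)) (k (Z t q - y t)) \<le> L * dist (Z t q - x t) (Z t q - y t)"
        by (intro lipschitz_onD[OF L]) auto
      then show ?thesis by (simp add: dist_norm norm_minus_commute)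
    qed
    show "norm ((\<integral>q. k (Z t q - x t) \<partial>N) - (\<integral>q. k (Z t q - y t) \<partial>N)) \<le> L * norm (x t - y t)"
      by (rule norm_integral_diff_le[OF N]) (use le Z tT in \<open>auto intro!: int AE_I2\<close>)
  qed (use \<open>x 0 = y 0\<close> b in auto)
  then show ?thesis by simp
qed

text \<open>For a kernel that is Lipschitz only on a ball, the flow is built for the kernel composed with the
  projection onto the ball. In the given time no particle moves farther than \<open>\<delta>\<close>, so all particles remain
  in \<open>A\<close> and the projection is never felt.\<close>
lemma local_mean_field_flow:
  fixes k :: "'a::euclidean_space \<Rightarrow> 'a" and c :: "'b \<Rightarrow> 'a"
  assumes N: "prob_space N" and c: "c \<in> borel_measurable N"
    and L: "L-lipschitz_on (cball 0 D) k" and "k 0 = 0"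
    and A: "\<And>a b. a \<in> A \<Longrightarrow> b \<in> A \<Longrightarrow> dist a b \<le> D"
      "\<And>z q. q \<in> space N \<Longrightarrow> dist z (c q) \<le> \<delta> \<Longrightarrow> z \<in> A"
    and \<delta>: "0 \<le> \<delta>"
    and T: "0 \<le> T" "4 * L * T \<le> 1" "L * D * T \<le> \<delta>"
  obtains x where "\<And>q. x 0 q = c q"
    "\<And>t. x t \<in> borel_measurable N"
    "\<And>t q. t \<in> {0..<T} \<Longrightarrow> q \<in> space N \<Longrightarrow> x t q \<in> A"
    "\<And>t p. t \<in> {0..<T} \<Longrightarrow> p \<in> space N \<Longrightarrow>
      ((\<lambda>s. x s p) has_vector_derivative (\<integral>q. k (x t q - x t p) \<partial>N)) (at t within {0..<T})"
proof -
  have L0: "0 \<le> L" using L lipschitz_on_nonneg by blast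
  obtain q where "q \<in> space N" using prob_space.not_empty[OF N] by blast
  then have "c q \<in> A" using A(2)[of q "c q"] \<delta> by simp
  then have D0: "0 \<le> D" using A(1)[of "c q" "c q"] by simp
  define H where "H w = k (closest_point (cball 0 D) w)" for w
  have cp: "closest_point (cball 0 D) w \<in> cball 0 D" for w :: 'a
    using D0 by (intro closest_point_in_set) auto
  have H: "L-lipschitz_on UNIV H"
  proof (rule lipschitz_onI)
    fix v w :: 'a
    have "dist (H v) (H w) \<le> L * dist (closest_point (cball 0 D) v) (closest_point (cball 0 D) w)"
      unfolding H_def by (rule lipschitz_onD[OF L cp cp])
    also have "\<dots> \<le> L * dist v w"
      using D0 L0 by (intro mult_left_mono closest_point_lipschitz) auto
    finally show "dist (H v) (H w) \<le> L * dist v w" .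
  qed (rule L0)
  have H_eq: "H w = k w" if "norm w \<le> D" for w
    using that by (simp add: H_def closest_point_self)
  have H_bound: "norm (H w) \<le> L * D" for w
  proof -
    have "norm (H w) \<le> L * norm (closest_point (cball 0 D) w)"
      using lipschitz_onD[OF L cp, of 0 w] D0 \<open>k 0 = 0\<close> by (simp add: H_def dist_norm)
    also have "\<dots> \<le> L * D" using cp[of w] L0 by (intro mult_left_mono) auto
    finally show ?thesis .
  qed
  obtain X where X: "\<And>p. X 0 p = p" "\<And>t. continuous_on UNIV (X t)"
    "\<And>t p. t \<in> {0..T} \<Longrightarrow>
      ((\<lambda>s. X s p) has_vector_derivative (\<integral>q. H (X t (c q) - X t p) \<partial>N)) (at t within {0..T})"
    "\<And>t p. t \<in> {0..T} \<Longrightarrow> dist (X t p) p \<le> L * D * t"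
  proof (rule mean_field_flow[OF N c H H_bound T(1,2)], goal_cases)
    case (1 X)
    show ?case by (rule that[of X]) (fact 1)+
  qed
  have ran: "X t (c q) \<in> A" if "t \<in> {0..<T}" "q \<in> space N" for t q
  proof (rule A(2)[OF that(2)])
    have "dist (X t (c q)) (c q) \<le> L * D * t" using X(4) that by simp
    also have "\<dots> \<le> L * D * T" using that L0 D0 by (intro mult_left_mono) auto
    finally show "dist (X t (c q)) (c q) \<le> \<delta>" using T(3) by simp
  qed
  show ?thesis
  proof (rule that[of "\<lambda>t q. X t (c q)"])
    show "(\<lambda>q. X t (c q)) \<in> borel_measurable N" for t
      by (rule measurable_compose[OF c borel_measurable_continuous_onI[OF X(2)]])
    show "((\<lambda>s. X s (c p)) has_vector_derivative (\<integral>q. k (X t (c q) - X t (c p)) \<partial>N))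
        (at t within {0..<T})" if t: "t \<in> {0..<T}" and p: "p \<in> space N" for t p
    proof -
      have "(\<integral>q. H (X t (c q) - X t (c p)) \<partial>N) = (\<integral>q. k (X t (c q) - X t (c p)) \<partial>N)"
        using A(1)[OF ran[OF t] ran[OF t p]]
        by (intro Bochner_Integration.integral_cong refl H_eq) (auto simp: dist_norm)
      then show ?thesis
        using has_vector_derivative_within_subset[OF X(3)[of t "c p"], of "{0..<T}"] t
        by (simp add: atLeastLessThan_subseteq_atLeastAtMost_iff)
    qed
  qed (use X ran in auto)
qed

text \<open>Here the sources move with the solution. The largest distance between \<open>X\<close> and \<open>Y\<close> is at most
  half of any bound on it, because the fields differ by at most \<open>2L\<close> times that bound and act for a time
  at most \<open>1/(4L)\<close>. The equations and the confinement to \<open>A\<close> are required only on a set \<open>G\<close> of full measure, which is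
  what the supports of a competing solution provide.\<close>
lemma mean_field_ode_unique:
  fixes k :: "'a::euclidean_space \<Rightarrow> 'a" and X Y :: "real \<Rightarrow> 'b \<Rightarrow> 'a"
  assumes N: "prob_space N" and k: "continuous_on UNIV k" and L: "L-lipschitz_on (cball 0 D) k"
    and T: "4 * L * T \<le> 1"
    and A: "bounded A" "\<And>a b. a \<in> A \<Longrightarrow> b \<in> A \<Longrightarrow> dist a b \<le> D"
    and G: "AE q in N. q \<in> G"
    and meas: "\<And>t. t \<in> {0..<T} \<Longrightarrow> X t \<in> borel_measurable N"
      "\<And>t. t \<in> {0..<T} \<Longrightarrow> Y t \<in> borel_measurable N"
    and ran: "\<And>t q. t \<in> {0..<T} \<Longrightarrow> q \<in> G \<Longrightarrow> X t q \<in> A"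
      "\<And>t q. t \<in> {0..<T} \<Longrightarrow> q \<in> G \<Longrightarrow> Y t q \<in> A"
    and init: "\<And>q. q \<in> G \<Longrightarrow> X 0 q = Y 0 q"
    and X: "\<And>t p. t \<in> {0..<T} \<Longrightarrow> p \<in> G \<Longrightarrow>
      ((\<lambda>s. X s p) has_vector_derivative (\<integral>q. k (X t q - X t p) \<partial>N)) (at t within {0..<T})"
    and Y: "\<And>t p. t \<in> {0..<T} \<Longrightarrow> p \<in> G \<Longrightarrow>
      ((\<lambda>s. Y s p) has_vector_derivative (\<integral>q. k (Y t q - Y t p) \<partial>N)) (at t within {0..<T})"
    and t: "t \<in> {0..<T}" and p: "p \<in> G"
  shows "X t p = Y t p"
proof -
  have L0: "0 \<le> L" using L lipschitz_on_nonneg by blast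
  have D0: "0 \<le> D" using A(2)[OF ran(1) ran(1), of t p t p] t p by simp
  have int: "integrable N (\<lambda>q. k (X t q - x))" "integrable N (\<lambda>q. k (Y t q - x))"
    if "t \<in> {0..<T}" for t x
    by (rule integrable_kernel_shift[OF prob_space.finite_measure[OF N] k _ _ A(1)];
        use that meas ran G in \<open>auto elim!: eventually_mono\<close>)+
  have half: "norm (X t p - Y t p) \<le> C / 2"
    if C: "\<And>t q. t \<in> {0..<T} \<Longrightarrow> q \<in> G \<Longrightarrow> norm (X t q - Y t q) \<le> C"
      and t: "t \<in> {0..<T}" and p: "p \<in> G" for C t p
  proof -
    have C0: "0 \<le> C" using C[OF t p] norm_ge_zero order_trans by blast
    define d where "d s = (\<integral>q. k (X s q - X s p) \<partial>N) - (\<integral>q. k (Y s q - Y s p) \<partial>N)" for s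
    have d: "norm (d s) \<le> 2 * L * C" if s: "s \<in> {0..<T}" for s
      unfolding d_def
    proof (rule norm_integral_diff_le[OF N int(1)[OF s] int(2)[OF s]])
      show "AE q in N. norm (k (X s q - X s p) - k (Y s q - Y s p)) \<le> 2 * L * C"
        using G
      proof eventually_elim
        case (elim q)
        have "dist (k (X s q - X s p)) (k (Y s q - Y s p)) \<le> L * dist (X s q - X s p) (Y s q - Y s p)"
          using A(2)[OF ran(1)[OF s elim] ran(1)[OF s p]] A(2)[OF ran(2)[OF s elim] ran(2)[OF s p]]
          by (intro lipschitz_onD[OF L]) (auto simp: dist_norm norm_minus_commute)
        also have "dist (X s q - X s p) (Y s q - Y s p) \<le> norm (X s q - Y s q) + norm (X s p - Y s p)"
          unfolding dist_norm
          using norm_triangle_ineq4[of "X s q - Y s q" "X s p - Y s p"] by (simp add: algebra_simps)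
        also have "\<dots> \<le> C + C"
          by (intro add_mono C s elim p)
        finally have "dist (k (X s q - X s p)) (k (Y s q - Y s p)) \<le> L * (C + C)"
          using L0 by (simp add: mult_left_mono)
        then show ?case by (simp add: dist_norm algebra_simps)
      qed
    qed
    have "norm ((X t p - Y t p) - (X 0 p - Y 0 p)) \<le> (2 * L * C) * norm (t - 0)"
    proof (rule differentiable_bound[of "{0..<T}" "\<lambda>s. X s p - Y s p" "\<lambda>s h. h *\<^sub>R d s"])
      fix s assume s: "s \<in> {0..<T}"
      show "((\<lambda>s. X s p - Y s p) has_derivative (\<lambda>h. h *\<^sub>R d s)) (at s within {0..<T})"
        using has_vector_derivative_diff[OF X[OF s p] Y[OF s p]]
        by (simp add: has_vector_derivative_def d_def)
      show "onorm (\<lambda>h. h *\<^sub>R d s) \<le> 2 * L * C"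
        by (rule onorm_bound)
           (use d[OF s] L0 C0 in \<open>auto simp: mult.commute[of _ "\<bar>_\<bar>"] intro!: mult_left_mono\<close>)
    qed (use t in auto)
    also have "\<dots> \<le> (2 * L * C) * T"
      using t L0 C0 by (intro mult_left_mono) auto
    also have "\<dots> \<le> C / 2"
      using mult_right_mono[OF T C0] by (simp add: mult_ac)
    finally show ?thesis using init[OF p] by simp
  qed
  have "\<forall>t\<in>{0..<T}. \<forall>p\<in>G. norm (X t p - Y t p) \<le> D * (1/2) ^ n" for n
  proof (induction n)
    case 0
    then show ?case using A(2) ran by (auto simp flip: dist_norm)
  next
    case (Suc n)
    then show ?case using half[of "D * (1/2) ^ n"] by auto
  qed
  then have "norm (X t p - Y t p) \<le> D * (1/2) ^ n" for n
    using t p by blast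
  moreover have "(\<lambda>n. D * (1/2) ^ n) \<longlonglongrightarrow> D * 0"
    by (intro tendsto_mult tendsto_const LIMSEQ_realpow_zero) auto
  ultimately have "norm (X t p - Y t p) \<le> D * 0"
    by (intro LIMSEQ_le_const) auto
  then show ?thesis by simp
qed

section \<open>Supports, push-forwards and narrow continuity\<close>

lemma space_borel_probs:
  assumes "\<mu> \<in> borel_probs S"
  shows "space \<mu> = S"
  using assms sets_eq_imp_space_eq[of \<mu> "restrict_space borel S"]
  by (simp add: borel_probs_def space_restrict_space)

lemma measurable_borel_probs:
  assumes "\<mu> \<in> borel_probs S" "continuous_on S f"
  shows "f \<in> borel_measurable \<mu>"
  using borel_measurable_continuous_on_restrict[OF assms(2)] assms(1)
  by (simp add: borel_probs_def cong: measurable_cong_sets)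

text \<open>The complement of the support is a union of open null sets, and countably many of them suffice
  because the topology is second countable.\<close>
lemma supp_full_measure:
  assumes "\<mu> \<in> borel_probs S"
  shows "supp \<mu> \<in> sets \<mu>" "AE x in \<mu>. x \<in> supp \<mu>"
proof -
  note sp = space_borel_probs[OF assms]
  have sets: "U \<inter> S \<in> sets \<mu>" if "open U" for U
    using assms that by (auto simp: borel_probs_def sets_restrict_space)
  define F where "F = {U. open U \<and> emeasure \<mu> (U \<inter> S) = 0}"
  obtain F' where F': "F' \<subseteq> F" "countable F'" "\<Union>F' = \<Union>F"
    by (rule Lindelof[of F]) (auto simp: F_def)
  have supp_eq: "supp \<mu> = space \<mu> - (\<Union>U\<in>F'. U \<inter> S)"
    using F'(3) by (auto simp: supp_def sp F_def zero_less_iff_neq_zero)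
  have null: "(\<Union>U\<in>F'. U \<inter> S) \<in> null_sets \<mu>"
    using F' sets by (intro null_sets_UN') (auto simp: F_def null_sets_def)
  then show "supp \<mu> \<in> sets \<mu>"
    unfolding supp_eq by auto
  show "AE x in \<mu>. x \<in> supp \<mu>"
    unfolding supp_eq using AE_not_in[OF null] AE_space by eventually_elim auto
qed

lemma prob_space_restrict_supp:
  assumes "\<mu> \<in> borel_probs S"
  shows "prob_space (restrict_space \<mu> (supp \<mu>))"
proof -
  interpret prob_space \<mu> using assms by (simp add: borel_probs_def)
  show ?thesis
    using supp_full_measure[OF assms] by (intro prob_space_restrict_space emeasure_eq_1_AE)
qed

lemma space_restrict_supp: "space (restrict_space \<mu> (supp \<mu>)) = supp \<mu>"
  by (auto simp: space_restrict_space supp_def)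

lemma measurable_restrict_supp:
  assumes "\<mu> \<in> borel_probs S" "continuous_on S f"
  shows "f \<in> borel_measurable (restrict_space \<mu> (supp \<mu>))"
  by (rule measurable_restrict_space1[OF measurable_borel_probs[OF assms]])

lemma distr_restrict_supp_id:
  assumes "\<mu> \<in> borel_probs S" "\<And>x. x \<in> supp \<mu> \<Longrightarrow> f x = x"
  shows "distr (restrict_space \<mu> (supp \<mu>)) (restrict_space borel S) f = \<mu>" (is "?D = \<mu>")
proof (rule measure_eqI)
  have sets: "sets \<mu> = sets (restrict_space borel S)"
    using assms by (simp add: borel_probs_def)
  then show "sets ?D = sets \<mu>" by simp
  note supp = supp_full_measure[OF assms(1)]
  fix A assume "A \<in> sets ?D"
  then have A: "A \<in> sets \<mu>" using sets by simp
  have id: "(\<lambda>x. x) \<in> restrict_space \<mu> (supp \<mu>) \<rightarrow>\<^sub>M restrict_space borel S"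
    by (rule measurable_restrict_space1) (simp add: sets cong: measurable_cong_sets)
  have f: "f \<in> restrict_space \<mu> (supp \<mu>) \<rightarrow>\<^sub>M restrict_space borel S"
    using id by (subst measurable_cong[where g="\<lambda>x. x"]) (auto simp: space_restrict_supp assms(2))
  have "emeasure ?D A = emeasure (restrict_space \<mu> (supp \<mu>)) (f -` A \<inter> supp \<mu>)"
    using A sets by (simp add: emeasure_distr[OF f] space_restrict_supp)
  also have "f -` A \<inter> supp \<mu> = A \<inter> supp \<mu>" using assms(2) by auto
  also have "emeasure (restrict_space \<mu> (supp \<mu>)) (A \<inter> supp \<mu>) = emeasure \<mu> (A \<inter> supp \<mu>)"
    using supp(1) by (intro emeasure_restrict_space) auto
  also have "\<dots> = emeasure \<mu> A"
    using supp A by (intro emeasure_eq_AE) auto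
  finally show "emeasure ?D A = emeasure \<mu> A" .
qed

lemma distr_in_borel_probs_within:
  assumes N: "prob_space N" and f: "f \<in> N \<rightarrow>\<^sub>M restrict_space borel S"
    and Q: "closed Q" "\<And>x. x \<in> space N \<Longrightarrow> f x \<in> Q"
  shows "distr N (restrict_space borel S) f \<in> borel_probs_within S Q" (is "?D \<in> _")
proof -
  have sp: "space ?D = S" by (simp add: space_restrict_space)
  have "p \<in> Q" if p: "p \<in> supp ?D" for p
  proof (rule ccontr)
    assume "p \<notin> Q"
    then have "0 < emeasure ?D (- Q \<inter> S)"
      using p open_Compl[OF Q(1)] unfolding supp_def sp by blast
    moreover have "- Q \<inter> S \<in> sets (restrict_space borel S)"
      using Q by (auto simp: sets_restrict_space)
    moreover have "f -` (- Q \<inter> S) \<inter> space N = {}" using Q by auto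
    ultimately show False by (simp add: emeasure_distr[OF f])
  qed
  then show ?thesis
    using prob_space.prob_space_distr[OF N f] by (auto simp: borel_probs_within_def borel_probs_def)
qed

text \<open>Dominated convergence: test functions are bounded and continuous, and paths are continuous.\<close>
lemma narrow_curve_distr:
  fixes f :: "real \<Rightarrow> 'b \<Rightarrow> 'a::euclidean_space"
  assumes N: "prob_space N"
    and f: "\<And>t. t \<in> {0..<T} \<Longrightarrow> f t \<in> N \<rightarrow>\<^sub>M restrict_space borel S"
    and Q: "closed Q" "\<And>t x. t \<in> {0..<T} \<Longrightarrow> x \<in> space N \<Longrightarrow> f t x \<in> Q"
    and cont: "\<And>x. x \<in> space N \<Longrightarrow> continuous_on {0..<T} (\<lambda>t. f t x)"
  shows "narrow_curve S Q T (\<lambda>t. distr N (restrict_space borel S) (f t))"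
proof -
  interpret prob_space N by (rule N)
  define \<rho> where "\<rho> t = distr N (restrict_space borel S) (f t)" for t
  have \<rho>: "\<rho> t \<in> borel_probs_within S Q" if "t \<in> {0..<T}" for t
    unfolding \<rho>_def using that by (intro distr_in_borel_probs_within N f Q)
  then have \<rho>': "\<rho> t \<in> borel_probs S" if "t \<in> {0..<T}" for t
    using that by (auto simp: borel_probs_within_def)
  have fS: "f t x \<in> S" if "t \<in> {0..<T}" "x \<in> space N" for t x
    using measurable_space[OF f] that by (simp add: space_restrict_space)
  have int_cont: "continuous_on {0..<T} (\<lambda>t. \<integral>p. \<phi> p \<partial>\<rho> t)"
    if \<phi>: "continuous_on S \<phi>" "bounded (\<phi> ` S)" for \<phi> :: "'a \<Rightarrow> real"
  proof -
    have \<phi>m: "\<phi> \<in> borel_measurable (restrict_space borel S)"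
      by (rule borel_measurable_continuous_on_restrict[OF \<phi>(1)])
    obtain b where b: "\<And>p. p \<in> S \<Longrightarrow> norm (\<phi> p) \<le> b"
      using \<phi>(2) unfolding bounded_iff by blast
    have "continuous_on {0..<T} (\<lambda>t. \<integral>x. \<phi> (f t x) \<partial>N)"
    proof (rule continuous_on_sequentiallyI)
      fix u a assume u: "\<forall>n. u n \<in> {0..<T}" "a \<in> {0..<T}" "u \<longlonglongrightarrow> a"
      show "(\<lambda>n. \<integral>x. \<phi> (f (u n) x) \<partial>N) \<longlonglongrightarrow> (\<integral>x. \<phi> (f a x) \<partial>N)"
      proof (rule integral_dominated_convergence[where w="\<lambda>_. b"])
        show "AE x in N. (\<lambda>n. \<phi> (f (u n) x)) \<longlonglongrightarrow> \<phi> (f a x)"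
        proof (rule AE_I2)
          fix x assume x: "x \<in> space N"
          have "continuous_on {0..<T} (\<lambda>t. \<phi> (f t x))"
            using fS x by (intro continuous_on_compose2[OF \<phi>(1) cont]) auto
          then show "(\<lambda>n. \<phi> (f (u n) x)) \<longlonglongrightarrow> \<phi> (f a x)"
            using u unfolding continuous_on_sequentially comp_def by blast
        qed
      qed (use u fS b in \<open>auto intro!: measurable_compose[OF f \<phi>m]\<close>)
    qed
    moreover have "(\<integral>p. \<phi> p \<partial>\<rho> t) = (\<integral>x. \<phi> (f t x) \<partial>N)" if "t \<in> {0..<T}" for t
      unfolding \<rho>_def by (rule integral_distr[OF f[OF that] \<phi>m])
    ultimately show ?thesis by (subst continuous_on_cong[OF refl]) auto
  qed
  have "continuous_map (top_of_set {0..<T}) (narrow_topology S) \<rho>"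
    unfolding narrow_topology_def
  proof (rule continuous_on_generated_topo)
    fix W assume "W \<in> {{\<mu> \<in> borel_probs S. (\<integral>p. \<phi> p \<partial>\<mu>) \<in> U} | (\<phi> :: 'a \<Rightarrow> real) U.
        continuous_on S \<phi> \<and> bounded (\<phi> ` S) \<and> open U}"
    then obtain \<phi> :: "'a \<Rightarrow> real" and U where W: "W = {\<mu> \<in> borel_probs S. (\<integral>p. \<phi> p \<partial>\<mu>) \<in> U}"
      and \<phi>: "continuous_on S \<phi>" "bounded (\<phi> ` S)" and "open U" by blast
    have "\<rho> -` W \<inter> topspace (top_of_set {0..<T}) = {0..<T} \<inter> (\<lambda>t. \<integral>p. \<phi> p \<partial>\<rho> t) -` U"
      using \<rho>' by (auto simp: W)
    then show "openin (top_of_set {0..<T}) (\<rho> -` W \<inter> topspace (top_of_set {0..<T}))"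
      using continuous_openin_preimage_gen[OF int_cont[OF \<phi>] \<open>open U\<close>] by simp
  next
    have "borel_probs S \<in> {{\<mu> \<in> borel_probs S. (\<integral>p. \<phi> p \<partial>\<mu>) \<in> U} | (\<phi> :: 'a \<Rightarrow> real) U.
        continuous_on S \<phi> \<and> bounded (\<phi> ` S) \<and> open U}"
      by (rule CollectI, rule exI[of _ "\<lambda>_. 0"], rule exI[of _ UNIV])
         (auto simp: bounded_iff image_def)
    moreover have "\<rho> ` topspace (top_of_set {0..<T}) \<subseteq> borel_probs S"
      using \<rho>' by auto
    ultimately show "\<rho> ` topspace (top_of_set {0..<T}) \<subseteq> \<Union> {{\<mu> \<in> borel_probs S. (\<integral>p. \<phi> p \<partial>\<mu>) \<in> U} |
        (\<phi> :: 'a \<Rightarrow> real) U. continuous_on S \<phi> \<and> bounded (\<phi> ` S) \<and> open U}"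
      by (meson Union_upper order_trans)
  qed
  then show ?thesis
    unfolding narrow_curve_def \<rho>_def[symmetric, abs_def]
    using \<rho> by (auto simp: continuous_map_in_subtopology)
qed

lemma narrow_curve_supp:
  assumes "narrow_curve S Q T \<rho>" "t \<in> {0..<T}"
  shows "\<rho> t \<in> borel_probs_within S Q"
  using assms continuous_map_image_subset_topspace[of "top_of_set {0..<T}" _ \<rho>]
  by (fastforce simp: narrow_curve_def)

text \<open>Each single time costs a null set of paths. Rational times cost only a null set altogether, and a
  continuous path that is in the closed set \<open>Q\<close> at all rational times never leaves it.\<close>
lemma AE_path_stays_in_supports:
  fixes \<Phi> :: "real \<Rightarrow> 'b \<Rightarrow> 'a::euclidean_space"
  assumes \<Phi>: "\<And>s. s \<in> {0..<T} \<Longrightarrow> \<Phi> s \<in> N \<rightarrow>\<^sub>M restrict_space borel S"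
    and cont: "\<And>q. q \<in> space N \<Longrightarrow> continuous_on {0..<T} (\<lambda>s. \<Phi> s q)"
    and supp: "\<And>s. s \<in> {0..<T} \<Longrightarrow>
      distr N (restrict_space borel S) (\<Phi> s) \<in> borel_probs_within S Q"
    and Q: "closed Q"
  shows "AE q in N. \<forall>s\<in>{0..<T}. \<Phi> s q \<in> Q"
proof -
  have "AE q in N. \<forall>s \<in> {0..<T} \<inter> \<rat>. \<Phi> s q \<in> Q"
  proof (subst AE_ball_countable)
    show "countable ({0..<T} \<inter> \<rat>)" using countable_rat by (rule countable_Int2)
    show "\<forall>s\<in>{0..<T} \<inter> \<rat>. AE q in N. \<Phi> s q \<in> Q"
    proof
      fix s assume "s \<in> {0..<T} \<inter> \<rat>"
      then have s: "s \<in> {0..<T}" by simp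
      let ?D = "distr N (restrict_space borel S) (\<Phi> s)"
      have "?D \<in> borel_probs S" "supp ?D \<subseteq> Q"
        using supp[OF s] by (auto simp: borel_probs_within_def)
      then have "AE R in ?D. R \<in> Q"
        using supp_full_measure(2)[of ?D S] by (auto elim!: eventually_mono)
      then show "AE q in N. \<Phi> s q \<in> Q"
        by (rule AE_distrD[OF \<Phi>[OF s]])
    qed
  qed
  then show ?thesis
    using AE_space
  proof eventually_elim
    case (elim q)
    show ?case
    proof (intro ballI, rule ccontr)
      fix s assume s: "s \<in> {0..<T}" and "\<Phi> s q \<notin> Q"
      moreover have "((\<lambda>r. \<Phi> r q) \<longlongrightarrow> \<Phi> s q) (at s within {0..<T})"
        using cont[OF elim(2)] s by (auto simp: continuous_on_def)
      ultimately have "\<forall>\<^sub>F r in at s within {0..<T}. \<Phi> r q \<in> - Q"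
        using Q by (intro topological_tendstoD) auto
      then obtain d where d: "d > 0" "\<And>r. r \<in> {0..<T} \<Longrightarrow> r \<noteq> s \<Longrightarrow> dist r s < d \<Longrightarrow> \<Phi> r q \<notin> Q"
        unfolding eventually_at by auto
      obtain r where "r \<in> \<rat>" "s < r" "r < min (s + d) T"
        using Rats_dense_in_real[of s "min (s + d) T"] s d by auto
      then show False using d(2)[of r] elim(1) s by (auto simp: dist_real_def)
    qed
  qed
qed

section \<open>Velocity fields and flow maps in the chart\<close>

locale cylinder_interaction =
  fixes \<epsilon> :: real and K :: "real^3 \<Rightarrow> real^3 \<Rightarrow> real" and g g' :: "real \<Rightarrow> real"
  assumes eps: "0 < \<epsilon>"
    and K: "\<And>P Q. P \<in> cylinder \<Longrightarrow> Q \<in> cylinder \<Longrightarrow> K P Q = g ((geodesic_dist cylinder P Q)\<^sup>2)"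
    and g: "\<And>s. 0 \<le> s \<Longrightarrow> (g has_real_derivative g' s) (at s within {0..})"
    and g': "local_lipschitz (UNIV :: real set) {0..} (\<lambda>_. g')"
begin

lemma strip_subset: "P \<in> strip \<epsilon> \<Longrightarrow> P \<in> cylinder" "P \<in> strip \<epsilon> \<Longrightarrow> P$2 > 0"
  using strip_half_cylinder eps by auto

lemma continuous_on_coord: "continuous_on (strip \<epsilon>) coord"
  using coord_has_derivative[OF strip_subset]
  by (meson continuous_on_eq_continuous_within has_derivative_continuous)

lemma continuous_on_kern: "continuous_on UNIV (kern g')"
  by (rule continuous_on_if_lipschitz_on_cballs[OF kern_lipschitz[OF g']])

text \<open>In the chart the velocity is an average of \<^const>\<open>kern\<close>. The compact set \<open>Q\<close> makes the
  integrand bounded almost everywhere, so that the integral exists and commutes with the frame.\<close>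
lemma velocity_eq_frame:
  assumes \<rho>: "\<rho> t \<in> borel_probs_within (strip \<epsilon>) Q" and Q: "compact Q" "Q \<subseteq> strip \<epsilon>"
    and P: "P \<in> strip \<epsilon>"
  shows "velocity K \<rho> P t = frame P (\<integral>R. kern g' (coord R - coord P) \<partial>\<rho> t)"
proof -
  have \<rho>': "\<rho> t \<in> borel_probs (strip \<epsilon>)" and supp: "supp (\<rho> t) \<subseteq> Q"
    using \<rho> by (auto simp: borel_probs_within_def)
  interpret prob_space "\<rho> t" using \<rho>' by (simp add: borel_probs_def)
  have "bounded (coord ` Q)"
    using Q by (intro compact_imp_bounded compact_continuous_image continuous_on_subset[OF continuous_on_coord])
  then have int: "integrable (\<rho> t) (\<lambda>R. kern g' (coord R - coord P))"
    using supp_full_measure(2)[OF \<rho>'] supp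
    by (intro integrable_kernel_shift[where A="coord ` Q"] finite_measure_axioms continuous_on_kern
        measurable_borel_probs[OF \<rho>' continuous_on_coord]) (auto elim!: eventually_mono)
  have "velocity K \<rho> P t = - (\<integral>R. - frame P (kern g' (coord R - coord P)) \<partial>\<rho> t)"
    unfolding velocity_def
    using cyl_grad_interaction[OF K g strip_subset[OF P] strip_subset]
    by (intro arg_cong[where f=uminus] Bochner_Integration.integral_cong refl)
       (simp add: space_borel_probs[OF \<rho>'])
  also have "\<dots> = (\<integral>R. frame P (kern g' (coord R - coord P)) \<partial>\<rho> t)"
    by simp
  also have "\<dots> = frame P (\<integral>R. kern g' (coord R - coord P) \<partial>\<rho> t)"
    by (rule integral_bounded_linear[OF bounded_linear_frame int])
  finally show ?thesis .
qed

text \<open>This turns the flow equation on the cylinder into an ordinary differential equation in the plane.\<close>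
lemma flow_map_velocity_iff:
  assumes \<rho>: "\<And>t. t \<in> {0..<T} \<Longrightarrow> \<rho> t \<in> borel_probs_within (strip \<epsilon>) Q"
    and Q: "compact Q" "Q \<subseteq> strip \<epsilon>"
    and \<Psi>: "\<And>t p. t \<in> {0..<T} \<Longrightarrow> p \<in> \<Sigma> \<Longrightarrow> \<Psi> t p \<in> strip \<epsilon>" "\<And>p. p \<in> \<Sigma> \<Longrightarrow> \<Psi> 0 p = p"
  shows "flow_map (strip \<epsilon>) (velocity K \<rho>) \<Sigma> T \<Psi> \<longleftrightarrow>
    (\<forall>p\<in>\<Sigma>. \<forall>t\<in>{0..<T}. ((\<lambda>s. coord (\<Psi> s p)) has_vector_derivative
      (\<integral>R. kern g' (coord R - coord (\<Psi> t p)) \<partial>\<rho> t)) (at t within {0..<T}))"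
proof -
  have "((\<lambda>s. \<Psi> s p) has_vector_derivative velocity K \<rho> (\<Psi> t p) t) (at t within {0..<T}) \<longleftrightarrow>
      ((\<lambda>s. coord (\<Psi> s p)) has_vector_derivative
        (\<integral>R. kern g' (coord R - coord (\<Psi> t p)) \<partial>\<rho> t)) (at t within {0..<T})"
    (is "?L \<longleftrightarrow> (_ has_vector_derivative ?v) _")
    if p: "p \<in> \<Sigma>" and t: "t \<in> {0..<T}" for p t
  proof -
    note in_strip = \<Psi>(1)[OF t p]
    have vel: "velocity K \<rho> (\<Psi> t p) t = frame (\<Psi> t p) ?v"
      by (rule velocity_eq_frame[of \<rho> t, OF \<rho>[OF t] Q in_strip])
    show ?thesis
    proof
      assume ?L
      from coord_path_has_vector_derivative[OF this strip_subset[OF in_strip]]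
      show "((\<lambda>s. coord (\<Psi> s p)) has_vector_derivative ?v) (at t within {0..<T})"
        by (simp add: vel coframe_frame strip_subset in_strip)
    next
      assume "((\<lambda>s. coord (\<Psi> s p)) has_vector_derivative ?v) (at t within {0..<T})"
      from chart_path_has_vector_derivative[OF this]
      have "((\<lambda>s. chart (coord (\<Psi> s p))) has_vector_derivative frame (\<Psi> t p) ?v) (at t within {0..<T})"
        by (simp add: chart_coord[OF in_strip eps])
      then show ?L
        unfolding vel
        by (rule has_vector_derivative_transform[OF t, rotated])
           (simp add: chart_coord[OF \<Psi>(1)[OF _ p] eps])
    qed
  qed
  then show ?thesis
    using \<Psi> by (auto simp: flow_map_def)
qed

lemma flow_map_velocityD:
  assumes \<rho>: "\<And>t. t \<in> {0..<T} \<Longrightarrow> \<rho> t \<in> borel_probs_within (strip \<epsilon>) Q"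
    and Q: "compact Q" "Q \<subseteq> strip \<epsilon>"
    and \<Psi>: "flow_map (strip \<epsilon>) (velocity K \<rho>) \<Sigma> T \<Psi>"
    and p: "p \<in> \<Sigma>" and t: "t \<in> {0..<T}"
  shows "((\<lambda>s. coord (\<Psi> s p)) has_vector_derivative
      (\<integral>R. kern g' (coord R - coord (\<Psi> t p)) \<partial>\<rho> t)) (at t within {0..<T})"
proof -
  have "\<Psi> s q \<in> strip \<epsilon>" "\<Psi> 0 q = q" if "s \<in> {0..<T}" "q \<in> \<Sigma>" for s q
    using \<Psi> that by (auto simp: flow_map_def)
  then show ?thesis
    using flow_map_velocity_iff[where \<rho>=\<rho> and T=T and \<Sigma>=\<Sigma> and \<Psi>=\<Psi>, OF \<rho> Q] \<Psi> p t by blast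
qed

lemma integral_kern_pushforward:
  assumes f: "f \<in> N \<rightarrow>\<^sub>M restrict_space borel (strip \<epsilon>)"
  shows "(\<integral>R. kern g' (coord R - x) \<partial>distr N (restrict_space borel (strip \<epsilon>)) f)
    = (\<integral>q. kern g' (coord (f q) - x) \<partial>N)"
  by (rule integral_distr[OF f])
     (intro borel_measurable_continuous_on_restrict continuous_on_compose2[OF continuous_on_kern]
        continuous_intros continuous_on_coord subset_UNIV)

end

section \<open>Short-time well-posedness\<close>

theorem theorem5p1:
  fixes \<epsilon> :: real
    and K :: "real^3 \<Rightarrow> real^3 \<Rightarrow> real"
    and g g' :: "real \<Rightarrow> real"
    and \<rho>0 :: "(real^3) measure"
  assumes eps: "\<epsilon> \<in> {0<..<pi}"
    and K: "\<And>P Q. P \<in> cylinder \<Longrightarrow> Q \<in> cylinder \<Longrightarrow> K P Q = g ((geodesic_dist cylinder P Q)\<^sup>2)"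
    and g: "\<And>s. 0 \<le> s \<Longrightarrow> (g has_real_derivative g' s) (at s within {0..})"
    and g': "local_lipschitz (UNIV :: real set) {0..} (\<lambda>_. g')"
    and rho0: "\<rho>0 \<in> borel_probs_compact (strip \<epsilon>)"
  shows "\<exists>T>0. \<exists>Q. compact Q \<and> supp \<rho>0 \<subseteq> Q \<and> Q \<subseteq> strip \<epsilon> \<and>
    (\<exists>\<rho>. narrow_curve (strip \<epsilon>) Q T \<rho> \<and> \<rho> 0 = \<rho>0 \<and> weak_solution \<epsilon> K T \<rho> \<and>
      (\<forall>\<sigma>. narrow_curve (strip \<epsilon>) Q T \<sigma> \<and> \<sigma> 0 = \<rho>0 \<and> weak_solution \<epsilon> K T \<sigma> \<longrightarrow>
        (\<forall>t\<in>{0..<T}. \<sigma> t = \<rho> t)))"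
proof -
  interpret cylinder_interaction \<epsilon> K g g'
    using eps K g g' by unfold_locales auto
  let ?B = "restrict_space borel (strip \<epsilon>) :: (real^3) measure"
  have bp: "\<rho>0 \<in> borel_probs (strip \<epsilon>)" and cs: "compact (supp \<rho>0)"
    using rho0 by (auto simp: borel_probs_compact_def)
  define \<Sigma> where "\<Sigma> = supp \<rho>0"
  \<comment> \<open>The particles are labelled by their initial positions.\<close>
  define N where "N = restrict_space \<rho>0 \<Sigma>"
  have N: "prob_space N" and spN: "space N = \<Sigma>"
    unfolding N_def \<Sigma>_def by (rule prob_space_restrict_supp[OF bp] space_restrict_supp)+
  have N_meas: "f \<in> borel_measurable N" if "continuous_on (strip \<epsilon>) f" for f :: "real^3 \<Rightarrow> real \<times> real"
    unfolding N_def \<Sigma>_def by (rule measurable_restrict_supp[OF bp that])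
  have \<Sigma>_strip: "\<Sigma> \<subseteq> strip \<epsilon>"
    using space_borel_probs[OF bp] by (auto simp: \<Sigma>_def supp_def)
  have chart_cont: "continuous_on A chart" for A
    using chart_has_derivative by (meson continuous_on_eq_continuous_within has_derivative_continuous)
  have cs0: "compact (coord ` \<Sigma>)"
    using cs \<Sigma>_strip unfolding \<Sigma>_def
    by (intro compact_continuous_image continuous_on_subset[OF continuous_on_coord])
  have dom: "coord ` \<Sigma> \<subseteq> chart_dom \<epsilon>"
    using \<Sigma>_strip chart_coord eps by auto
  have "open (chart_dom \<epsilon>)"
    unfolding chart_dom_def by (intro open_Times) auto
  then obtain \<delta> where \<delta>: "\<delta> > 0" "(\<Union>x\<in>coord ` \<Sigma>. cball x \<delta>) \<subseteq> chart_dom \<epsilon>"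
    using compact_subset_open_imp_cball_epsilon_subset[OF cs0 _ dom] by blast
  \<comment> \<open>A closed neighbourhood of the initial support in the chart, leaving each particle the room \<open>\<delta>\<close> to move.\<close>
  define Q0 where "Q0 = {x + y | x y. x \<in> coord ` \<Sigma> \<and> y \<in> cball 0 \<delta>}"
  have Q0: "compact Q0" unfolding Q0_def by (intro compact_sums cs0 compact_cball)
  have Q0_I: "x \<in> Q0" if "p \<in> \<Sigma>" "dist x (coord p) \<le> \<delta>" for x p
  proof -
    have "x = coord p + (x - coord p)" by simp
    moreover have "x - coord p \<in> cball 0 \<delta>"
      using that(2) unfolding mem_cball_0 dist_norm .
    ultimately show ?thesis unfolding Q0_def using that(1) by blast
  qed
  have Q0_dom: "Q0 \<subseteq> chart_dom \<epsilon>"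
  proof
    fix z assume "z \<in> Q0"
    then obtain x y where xy: "z = x + y" "x \<in> coord ` \<Sigma>" "y \<in> cball 0 \<delta>"
      unfolding Q0_def by blast
    then have "z \<in> cball x \<delta>" by (simp add: dist_norm)
    then show "z \<in> chart_dom \<epsilon>" using \<delta>(2) xy(2) by blast
  qed
  define D where "D = diameter Q0"
  have D: "dist a b \<le> D" if "a \<in> Q0" "b \<in> Q0" for a b
    unfolding D_def using diameter_bounded_bound[OF compact_imp_bounded[OF Q0]] that by blast
  obtain p0 where p0: "p0 \<in> \<Sigma>" using prob_space.not_empty[OF N] spN by blast
  have D0: "0 \<le> D" using D[OF Q0_I Q0_I, of p0 "coord p0" p0 "coord p0"] p0 \<delta> by simp
  obtain L where L: "L-lipschitz_on (cball 0 D) (kern g')" using kern_lipschitz[OF g'] by blast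
  have L0: "0 \<le> L" using L lipschitz_on_nonneg by blast
  \<comment> \<open>Particles have speed at most \<open>L * D\<close>, so they travel at most \<open>\<delta>\<close>; the second bound makes the
    Picard operator and the uniqueness argument contract. The summands \<open>1\<close> avoid division by zero.\<close>
  define T where "T = min (\<delta> / (L * D + 1)) (1 / (4 * L + 1))"
  have LD0: "0 \<le> L * D" using L0 D0 by simp
  have T0: "T > 0" using \<delta> L0 LD0 by (simp add: T_def add_nonneg_pos)
  have LT: "4 * L * T \<le> 1"
  proof -
    have "4 * L * T \<le> 4 * L * (1 / (4 * L + 1))"
      using L0 by (intro mult_left_mono) (auto simp: T_def)
    also have "\<dots> \<le> 1" using L0 by (simp add: field_simps)
    finally show ?thesis .
  qed
  have MT: "L * D * T \<le> \<delta>"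
  proof -
    have "L * D * T \<le> L * D * (\<delta> / (L * D + 1))"
      using LD0 by (intro mult_left_mono) (auto simp: T_def)
    also have "\<dots> \<le> \<delta>" using LD0 \<delta> by (simp add: divide_le_eq algebra_simps)
    finally show ?thesis .
  qed
  obtain x where x0: "\<And>q. x 0 q = coord q"
    and x_meas: "\<And>t. x t \<in> borel_measurable N"
    and xQ0: "\<And>t q. t \<in> {0..<T} \<Longrightarrow> q \<in> space N \<Longrightarrow> x t q \<in> Q0"
    and x_der: "\<And>t p. t \<in> {0..<T} \<Longrightarrow> p \<in> space N \<Longrightarrow>
      ((\<lambda>s. x s p) has_vector_derivative (\<integral>q. kern g' (x t q - x t p) \<partial>N)) (at t within {0..<T})"
    by (rule local_mean_field_flow[OF N N_meas[OF continuous_on_coord] L _ D _ less_imp_le[OF \<delta>(1)] less_imp_le[OF T0] LT MT])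
      (auto simp: kern_def spN intro: Q0_I that)
  note xQ0 = xQ0[unfolded spN] and x_der = x_der[unfolded spN]
  define \<Psi> where "\<Psi> t p = chart (x t p)" for t p
  define Q where "Q = chart ` Q0"
  have Q: "compact Q" "Q \<subseteq> strip \<epsilon>"
    using Q0 Q0_dom by (auto simp: Q_def strip_eq_chart_image intro!: compact_continuous_image chart_cont)
  have \<Psi>Q: "\<Psi> t p \<in> Q" if "t \<in> {0..<T}" "p \<in> \<Sigma>" for t p
    using xQ0[OF that] by (simp add: \<Psi>_def Q_def)
  have coord_chart': "coord (chart a) = a" if "a \<in> Q0" for a
    using that Q0_dom eps by (intro coord_chart) (auto simp: chart_dom_def)
  have coord_\<Psi>: "coord (\<Psi> t p) = x t p" if "t \<in> {0..<T}" "p \<in> \<Sigma>" for t p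
    using xQ0[OF that] by (simp add: \<Psi>_def coord_chart')
  have coord_Q: "coord P \<in> Q0" if "P \<in> Q" for P
    using that by (auto simp: Q_def coord_chart')
  have \<Psi>0: "\<Psi> 0 p = p" if "p \<in> \<Sigma>" for p
    using that \<Sigma>_strip chart_coord eps by (auto simp: \<Psi>_def x0)
  have \<Sigma>Q: "\<Sigma> \<subseteq> Q" using \<Psi>Q[of 0] \<Psi>0 T0 by force
  have \<Psi>_meas: "\<Psi> t \<in> N \<rightarrow>\<^sub>M ?B" if t: "t \<in> {0..<T}" for t
  proof -
    have "\<Psi> t \<in> borel_measurable N"
      unfolding \<Psi>_def[abs_def]
      using x_meas by (rule measurable_compose) (rule borel_measurable_continuous_onI[OF chart_cont])
    then show ?thesis
      using \<Psi>Q[OF t] Q by (auto simp: measurable_restrict_space2_iff spN)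
  qed
  define \<rho> where "\<rho> t = distr N ?B (\<Psi> t)" for t
  have \<rho>: "\<rho> t \<in> borel_probs_within (strip \<epsilon>) Q" if "t \<in> {0..<T}" for t
    unfolding \<rho>_def using \<Psi>Q[OF that] Q
    by (intro distr_in_borel_probs_within N \<Psi>_meas that) (auto simp: spN compact_imp_closed)
  have curve: "narrow_curve (strip \<epsilon>) Q T \<rho>"
    unfolding \<rho>_def[abs_def]
  proof (rule narrow_curve_distr[OF N \<Psi>_meas])
    fix p assume "p \<in> space N"
    then have "continuous_on {0..<T} (\<lambda>t. x t p)"
      using x_der spN by (metis continuous_on_eq_continuous_within has_vector_derivative_continuous)
    then show "continuous_on {0..<T} (\<lambda>t. \<Psi> t p)"
      unfolding \<Psi>_def by (intro continuous_on_compose2[OF chart_cont[of UNIV]]) auto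
  qed (use \<Psi>Q spN Q in \<open>auto simp: compact_imp_closed\<close>)
  have \<rho>_0: "\<rho> 0 = \<rho>0"
    unfolding \<rho>_def N_def \<Sigma>_def
    by (rule distr_restrict_supp_id[OF bp]) (simp add: \<Psi>0 \<Sigma>_def)
  have int_\<rho>: "(\<integral>R. kern g' (coord R - z) \<partial>\<rho> t) = (\<integral>q. kern g' (x t q - z) \<partial>N)"
    if t: "t \<in> {0..<T}" for t z
    unfolding \<rho>_def integral_kern_pushforward[OF \<Psi>_meas[OF t]]
    by (intro Bochner_Integration.integral_cong refl) (simp add: spN coord_\<Psi>[OF t])
  have flow: "flow_map (strip \<epsilon>) (velocity K \<rho>) \<Sigma> T \<Psi>"
  proof (subst flow_map_velocity_iff[OF \<rho> Q])
    show "\<forall>p\<in>\<Sigma>. \<forall>t\<in>{0..<T}. ((\<lambda>s. coord (\<Psi> s p)) has_vector_derivative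
      (\<integral>R. kern g' (coord R - coord (\<Psi> t p)) \<partial>\<rho> t)) (at t within {0..<T})"
    proof (intro ballI)
      fix p t assume p: "p \<in> \<Sigma>" and t: "t \<in> {0..<T}"
      show "((\<lambda>s. coord (\<Psi> s p)) has_vector_derivative
        (\<integral>R. kern g' (coord R - coord (\<Psi> t p)) \<partial>\<rho> t)) (at t within {0..<T})"
        unfolding int_\<rho>[OF t] coord_\<Psi>[OF t p]
        by (rule has_vector_derivative_transform[OF t _ x_der[OF t p]]) (simp add: coord_\<Psi> p)
    qed
  qed (use \<Psi>Q Q \<Psi>0 in auto)
  \<comment> \<open>A flow map is only asked to stay in the strip, which is unbounded, so its path in the chart comes
    without a bound.\<close>
  have flow_unique: "\<Phi> t p = \<Psi> t p"
    if \<Phi>: "flow_map (strip \<epsilon>) (velocity K \<rho>) \<Sigma> T \<Phi>" and t: "t \<in> {0..<T}" and p: "p \<in> \<Sigma>" for \<Phi> t p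
  proof -
    have \<Phi>s: "\<Phi> s q \<in> strip \<epsilon>" "\<Phi> 0 q = q" if "s \<in> {0..<T}" "q \<in> \<Sigma>" for s q
      using \<Phi> that by (auto simp: flow_map_def)
    have \<Phi>_der: "((\<lambda>s. coord (\<Phi> s p)) has_vector_derivative
        (\<integral>q. kern g' (x r q - coord (\<Phi> r p)) \<partial>N)) (at r within {0..<T})" if "r \<in> {0..<T}" for r
      using flow_map_velocityD[OF \<rho> Q \<Phi> p that] by (simp only: int_\<rho>[OF that])
    have "coord (\<Phi> t p) = x t p"
    proof (rule transport_ode_unique[where x="\<lambda>s. coord (\<Phi> s p)" and y="\<lambda>s. x s p" and Z=x,
          OF N kern_lipschitz[OF g'] x_meas _ compact_imp_bounded[OF Q0] \<Phi>_der x_der[OF _ p] _ t])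
      show "coord (\<Phi> 0 p) = x 0 p" using \<Phi>s(2)[OF t p] x0 by simp
    qed (use xQ0 spN in auto)
    then show ?thesis
      using chart_coord[OF \<Phi>s(1)[OF t p] eps] by (simp add: \<Psi>_def)
  qed
  have sol: "weak_solution \<epsilon> K T \<rho>"
    unfolding weak_solution_def \<rho>_0 \<Sigma>_def[symmetric]
  proof (intro conjI exI[of _ \<Psi>])
    show "\<forall>t\<in>{0..<T}. \<rho> t \<in> borel_probs (strip \<epsilon>)"
      using \<rho> by (auto simp: borel_probs_within_def)
    show "\<forall>t\<in>{0..<T}. is_pushforward (strip \<epsilon>) (\<Psi> t) \<rho>0 (\<rho> t)"
      using \<Psi>_meas unfolding is_pushforward_def \<rho>_def N_def \<Sigma>_def by blast
  qed (use flow flow_unique in auto)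
  have unique: "\<sigma> t = \<rho> t"
    if \<sigma>: "narrow_curve (strip \<epsilon>) Q T \<sigma>" "\<sigma> 0 = \<rho>0" "weak_solution \<epsilon> K T \<sigma>" and t: "t \<in> {0..<T}" for \<sigma> t
  proof -
    have \<sigma>Q: "\<sigma> s \<in> borel_probs_within (strip \<epsilon>) Q" if "s \<in> {0..<T}" for s
      by (rule narrow_curve_supp[OF \<sigma>(1) that])
    obtain \<Phi> where \<Phi>: "flow_map (strip \<epsilon>) (velocity K \<sigma>) \<Sigma> T \<Phi>"
      and push: "\<forall>t\<in>{0..<T}. is_pushforward (strip \<epsilon>) (\<Phi> t) \<rho>0 (\<sigma> t)"
      using \<sigma>(2,3) unfolding weak_solution_def \<Sigma>_def by auto
    have \<Phi>_meas: "\<Phi> s \<in> N \<rightarrow>\<^sub>M ?B" and \<sigma>_eq: "\<sigma> s = distr N ?B (\<Phi> s)" if "s \<in> {0..<T}" for s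
      using push that unfolding is_pushforward_def N_def \<Sigma>_def by auto
    have \<Phi>s: "\<Phi> s q \<in> strip \<epsilon>" "\<Phi> 0 q = q" if "s \<in> {0..<T}" "q \<in> \<Sigma>" for s q
      using \<Phi> that by (auto simp: flow_map_def)
    have \<Phi>_cont: "continuous_on {0..<T} (\<lambda>s. \<Phi> s q)" if "q \<in> \<Sigma>" for q
      using \<Phi> that unfolding flow_map_def continuous_on_eq_continuous_within
      by (blast intro: has_vector_derivative_continuous)
    define y where "y s q = coord (\<Phi> s q)" for s q
    have y_meas: "y s \<in> borel_measurable N" if "s \<in> {0..<T}" for s
      unfolding y_def[abs_def]
      by (rule measurable_compose[OF \<Phi>_meas[OF that]
            borel_measurable_continuous_on_restrict[OF continuous_on_coord]])
    have y_der: "((\<lambda>s. y s p) has_vector_derivative (\<integral>q. kern g' (y s q - y s p) \<partial>N))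
        (at s within {0..<T})" if s: "s \<in> {0..<T}" and p: "p \<in> \<Sigma>" for s p
    proof -
      have "(\<integral>R. kern g' (coord R - z) \<partial>\<sigma> s) = (\<integral>q. kern g' (y s q - z) \<partial>N)" for z
        unfolding \<sigma>_eq[OF s] y_def by (rule integral_kern_pushforward[OF \<Phi>_meas[OF s]])
      then show ?thesis
        using flow_map_velocityD[OF \<sigma>Q Q \<Phi> p s] by (simp only: flip: y_def)
    qed
    \<comment> \<open>The particles that the supports of the measures \<open>\<sigma> s\<close> confine to \<open>Q\<close>: almost all of them.\<close>
    define G where "G = {q \<in> \<Sigma>. \<forall>s\<in>{0..<T}. \<Phi> s q \<in> Q}"
    have "AE q in N. \<forall>s\<in>{0..<T}. \<Phi> s q \<in> Q"
      using \<Phi>_cont \<sigma>Q Q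
      by (intro AE_path_stays_in_supports[OF \<Phi>_meas]) (auto simp: spN \<sigma>_eq compact_imp_closed)
    then have G_AE: "AE q in N. q \<in> G"
      using AE_space by eventually_elim (simp add: G_def spN)
    have xy: "x t q = y t q" if "q \<in> G" for q
      by (rule mean_field_ode_unique[OF N continuous_on_kern L LT compact_imp_bounded[OF Q0] D G_AE
            x_meas y_meas _ _ _ x_der y_der t that])
         (use \<Phi>s(1) \<Phi>s(2)[of 0] T0 in \<open>auto simp: G_def xQ0 coord_Q y_def x0\<close>)
    have "AE q in N. \<Phi> t q = \<Psi> t q"
      using G_AE
    proof eventually_elim
      case (elim q)
      then show ?case
        using xy[OF elim] chart_coord[OF \<Phi>s(1)[OF t, of q] eps] by (simp add: \<Psi>_def y_def G_def)
    qed
    then show ?thesis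
      unfolding \<sigma>_eq[OF t] \<rho>_def by (intro distr_cong_AE refl \<Phi>_meas \<Psi>_meas t)
  qed
  have "supp \<rho>0 \<subseteq> Q" using \<Sigma>Q by (simp add: \<Sigma>_def)
  moreover have "\<forall>\<sigma>. narrow_curve (strip \<epsilon>) Q T \<sigma> \<and> \<sigma> 0 = \<rho>0 \<and> weak_solution \<epsilon> K T \<sigma> \<longrightarrow>
      (\<forall>t\<in>{0..<T}. \<sigma> t = \<rho> t)"
    by (intro allI impI ballI, elim conjE, rule unique)
  ultimately show ?thesis
    by (intro exI[of _ T] exI[of _ Q] exI[of _ \<rho>] conjI T0 Q curve \<rho>_0 sol)
qed

end
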